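(* Let $1\le p<\infty$ and let $d_1,d_2\in\mathbb{Z}$ with $d_1\neq d_2$. Consider the infimum $$\inf_{f\in\mathcal{E}_{d_1}}\ \inf_{g\in\mathcal{E}_{d_2}}\ \left(\int_{\mathbb{S}^1}|\dot f-\dot g|^p\right)^{1/p},$$ whose value is $2^{(1/p)+1}\pi^{(1/p)-1}|d_1-d_2|$. Then: (1) if $p=1$, this infimum is always achieved (by some $f\in\mathcal{E}_{d_1}$, $g\in\mathcal{E}_{d_2}$); (2) if $1<p<2$, this infimum is achieved if and only if $d_2=-d_1$; (3) if $p\ge 2$, this infimum is not achieved.
   Context: $\mathbb{S}^1\subset\mathbb{C}$ is the unit circle with arclength measure. For $1\le p<\infty$, $W^{1,p}(\mathbb{S}^1;\mathbb{S}^1)=\{f\in W^{1,p}(\mathbb{S}^1;\mathbb{R}^2): |f|=1\text{ a.e.}\}$; such maps are continuous and have a topological degree. $\dot f$ denotes the derivative of $f$ with respect to arclength (i.e. of $\theta\mapsto f(e^{i\theta})$). For $d\in\mathbb{Z}$, $\mathcal{E}_d=\{f\in W^{1,p}(\mathbb{S}^1;\mathbb{S}^1):\deg f=d\}$. *)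

theory Defs
  imports "HOL-Complex_Analysis.Complex_Analysis"
begin

text \<open>Maps of the unit circle are parametrized by arclength theta in [0, 2 pi]:
  f(e^{i theta}) = F theta.  F is in W^{1,p}(S^1;S^1) with arclength derivative G iff
  F is the absolutely continuous primitive of G on [0, 2 pi], G is in L^p,
  F is 2 pi-periodic (closed loop) and |F| = 1.\<close>

definition W1p_circle :: "real \<Rightarrow> (real \<Rightarrow> complex) \<Rightarrow> (real \<Rightarrow> complex) \<Rightarrow> bool" where
  "W1p_circle p F G \<longleftrightarrow>
     G absolutely_integrable_on {0..2*pi} \<and>
     (\<lambda>t. norm (G t) powr p) integrable_on {0..2*pi} \<and>
     (\<forall>t\<in>{0..2*pi}. F t = F 0 + integral {0..t} G) \<and>
     F (2*pi) = F 0 \<and>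
     (\<forall>t\<in>{0..2*pi}. norm (F t) = 1)"

definition circ_deg :: "(real \<Rightarrow> complex) \<Rightarrow> complex" where
  "circ_deg F = winding_number (\<lambda>t. F (2*pi*t)) 0"

definition Lp_dist :: "real \<Rightarrow> (real \<Rightarrow> complex) \<Rightarrow> (real \<Rightarrow> complex) \<Rightarrow> real" where
  "Lp_dist p G H = (integral {0..2*pi} (\<lambda>t. norm (G t - H t) powr p)) powr (1/p)"

definition energies :: "real \<Rightarrow> int \<Rightarrow> int \<Rightarrow> real set" where
  "energies p d1 d2 = {Lp_dist p Gf Gg | F Gf H Gg.
      W1p_circle p F Gf \<and> W1p_circle p H Gg \<and>
      circ_deg F = of_int d1 \<and> circ_deg H = of_int d2}"

end

theory Submission
  imports Defs
begin

text \<open>Write \<open>f = e\<^bsup>i(m + \<eta>)\<^esup>\<close> and \<open>g = e\<^bsup>i(m - \<eta>)\<^esup>\<close> with continuous \<open>m\<close> and \<open>\<eta>\<close>, so that \<open>f - g = 2 i sin(\<eta>) e\<^bsup>im\<^esup>\<close> and \<open>\<eta>\<close> grows by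
  \<open>pi (d1 - d2)\<close> in total. The length of the curve \<open>f - g\<close> is at least the variation of \<open>2|sin \<eta>|\<close>, hence at least
  \<open>4 |d1 - d2|\<close>, and Jensen's inequality gives the lower bound for every \<open>p\<close>. When \<open>p > 1\<close>, equality forces
  \<open>f - g\<close> to have constant speed and to run along straight segments through the origin, so that \<open>m\<close> is constant
  (hence \<open>d1 + d2 = 0\<close>) and \<open>sin \<eta>\<close> is a triangle wave; the resulting square root singularity of \<open>\<eta>\<close> is in
  \<open>L\<^sup>p\<close> after differentiation only if \<open>p < 2\<close>. Conversely, one lets \<open>\<eta>\<close> follow (an approximation of) such a wave
  and moves \<open>m\<close> while \<open>\<eta>\<close> rests at a multiple of \<open>pi\<close>, which costs nothing.\<close>

section \<open>Strict convexity of powers and vanishing integrals\<close>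

text \<open>The mean value theorem reduces this to strict monotonicity of
  \<open>u powr (p - 1)\<close>. The derivative is computed only at positive points, so
  \<open>x = 0\<close> is separate; there the left side is
  \<open>(1 - p) * c powr p\<close>.\<close>

lemma powr_tangent_less:
  fixes p x c :: real
  assumes "1 < p" "0 \<le> x" "0 < c" "x \<noteq> c"
  shows "c powr p + p * c powr (p - 1) * (x - c) < x powr p"
proof (cases "x = 0")
  case True
  have "c powr p = c powr (p - 1) * c"
    using assms by (simp add: powr_diff)
  moreover have "0 < (p - 1) * (c powr (p - 1) * c)"
    using assms by simp
  ultimately show ?thesis using True by (simp add: algebra_simps)
next
  case False
  with assms have "0 < x" by simp
  have der: "((\<lambda>u. u powr p) has_real_derivative p * u powr (p - 1)) (at u)" if "u > 0" for u
    using that by (auto intro!: derivative_eq_intros simp: powr_diff field_simps)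
  show ?thesis
  proof (cases "c < x")
    case True
    obtain z where z: "c < z" "z < x" "x powr p - c powr p = (x - c) * (p * z powr (p - 1))"
      using MVT2[OF True, of "\<lambda>u. u powr p" "\<lambda>u. p * u powr (p - 1)"] der assms(3) by force
    have "c powr (p - 1) < z powr (p - 1)"
      using z assms by (intro powr_less_mono2) auto
    then have "(x - c) * (p * c powr (p - 1)) < (x - c) * (p * z powr (p - 1))"
      using True assms by simp
    then show ?thesis using z(3) by (simp add: algebra_simps)
  next
    case False
    with assms have "x < c" by simp
    obtain z where z: "x < z" "z < c" "c powr p - x powr p = (c - x) * (p * z powr (p - 1))"
      using MVT2[OF \<open>x < c\<close>, of "\<lambda>u. u powr p" "\<lambda>u. p * u powr (p - 1)"] der \<open>0 < x\<close> by force
    have "z powr (p - 1) < c powr (p - 1)"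
      using z assms \<open>0 < x\<close> by (intro powr_less_mono2) auto
    then have "(c - x) * (p * z powr (p - 1)) < (c - x) * (p * c powr (p - 1))"
      using \<open>x < c\<close> assms by simp
    then show ?thesis using z(3) by (simp add: algebra_simps)
  qed
qed

lemma powr_tangent_le:
  fixes p x c :: real
  assumes "1 \<le> p" "0 \<le> x" "0 < c"
  shows "c powr p + p * c powr (p - 1) * (x - c) \<le> x powr p"
proof (cases "p = 1 \<or> x = c")
  case True
  then show ?thesis using assms by auto
next
  case False
  then show ?thesis using powr_tangent_less[of p x c] assms by simp
qed

lemma integral_zero_imp_negligible:
  fixes f :: "real \<Rightarrow> real"
  assumes "f integrable_on {a..b}" "\<And>x. x \<in> {a..b} \<Longrightarrow> 0 \<le> f x" "integral {a..b} f = 0"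
  shows "negligible {x \<in> {a..b}. f x \<noteq> 0}"
proof -
  have ai: "f absolutely_integrable_on {a..b}"
    using assms by (intro nonnegative_absolutely_integrable_1) auto
  then have i: "integrable (lebesgue_on {a..b}) f"
    by (simp add: integrable_restrict_space set_integrable_def)
  have "integral\<^sup>L (lebesgue_on {a..b}) f = 0"
    using assms(3) i by (simp add: lebesgue_integral_eq_integral)
  then have "AE x in lebesgue_on {a..b}. f x = 0"
    by (subst (asm) integral_nonneg_eq_0_iff_AE[OF i]) (auto simp: assms)
  then have "AE x in lebesgue. x \<in> {a..b} \<longrightarrow> f x = 0"
    by (subst (asm) AE_restrict_space_iff) auto
  then show ?thesis
    by (auto simp: eventually_ae_filter_negligible intro: negligible_subset)
qed

section \<open>The primitive of \<open>|cos|\<close> and its control by the variation of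
  \<open>|sin|\<close>\<close>

text \<open>The primitive of \<open>|cos|\<close>, written out on the interval of length \<open>pi\<close> centred at the multiple of \<open>pi\<close>
  nearest to \<open>x\<close>.\<close>

definition cos_abs_primitive :: "real \<Rightarrow> real" where
  "cos_abs_primitive x = (let k = \<lfloor>(x + pi/2) / pi\<rfloor> in 2 * of_int k + sin (x - of_int k * pi))"

text \<open>Closed intervals are allowed because neighbouring formulas agree at the common endpoint:
  there the floor already picks \<open>k + 1\<close>, and both formulas give
  \<open>2 * k + 1\<close>.\<close>

lemma cos_abs_primitive_eq:
  assumes "of_int k * pi - pi/2 \<le> x" "x \<le> of_int k * pi + pi/2"
  shows "cos_abs_primitive x = 2 * of_int k + sin (x - of_int k * pi)"
proof (cases "x = of_int k * pi + pi/2")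
  case True
  have "x + pi/2 = of_int (k + 1) * pi"
    using True by (simp add: algebra_simps)
  then have "(x + pi/2) / pi = of_int (k + 1)"
    by simp
  then have "\<lfloor>(x + pi/2) / pi\<rfloor> = k + 1"
    by (simp only: floor_of_int)
  then show ?thesis using True
    unfolding cos_abs_primitive_def Let_def by (simp add: algebra_simps)
next
  case False
  then have "\<lfloor>(x + pi/2) / pi\<rfloor> = k"
    using assms by (intro floor_unique) (auto simp: pos_le_divide_eq pos_divide_less_eq algebra_simps)
  then show ?thesis unfolding cos_abs_primitive_def Let_def by simp
qed

lemma nearest_multiple_of_pi:
  obtains k :: int where "of_int k * pi - pi/2 \<le> x" "x < of_int k * pi + pi/2"
proof
  have "of_int \<lfloor>(x + pi/2) / pi\<rfloor> \<le> (x + pi/2) / pi" "(x + pi/2) / pi < of_int \<lfloor>(x + pi/2) / pi\<rfloor> + 1"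
    by linarith+
  then have "of_int \<lfloor>(x + pi/2) / pi\<rfloor> * pi \<le> x + pi/2" "x + pi/2 < (of_int \<lfloor>(x + pi/2) / pi\<rfloor> + 1) * pi"
    by (simp_all only: pos_le_divide_eq pos_divide_less_eq pi_gt_zero)
  then show "of_int \<lfloor>(x + pi/2) / pi\<rfloor> * pi - pi/2 \<le> x" "x < of_int \<lfloor>(x + pi/2) / pi\<rfloor> * pi + pi/2"
    by (auto simp: algebra_simps)
qed

lemma cos_abs_primitive_mono:
  assumes "x \<le> y"
  shows "cos_abs_primitive x \<le> cos_abs_primitive y"
proof -
  obtain k where k: "of_int k * pi - pi/2 \<le> x" "x < of_int k * pi + pi/2"
    by (rule nearest_multiple_of_pi)
  obtain l where l: "of_int l * pi - pi/2 \<le> y" "y < of_int l * pi + pi/2"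
    by (rule nearest_multiple_of_pi)
  note eq = cos_abs_primitive_eq[OF k(1) less_imp_le[OF k(2)]] cos_abs_primitive_eq[OF l(1) less_imp_le[OF l(2)]]
  have "of_int k * pi < of_int (l + 1) * pi"
    using k l assms by (simp add: algebra_simps)
  then have "k < l + 1"
    by (simp only: mult_less_cancel_right of_int_less_iff) (use pi_gt_zero in linarith)
  then consider "k = l" | "k + 1 \<le> l" by linarith
  then show ?thesis
  proof cases
    case 1
    then show ?thesis using k l assms unfolding eq
      by (intro add_mono mult_left_mono sin_monotone_2pi_le) auto
  next
    case 2
    then have "2 * real_of_int k + 2 \<le> 2 * of_int l" by linarith
    moreover have "sin (x - of_int k * pi) \<le> 1" "-1 \<le> sin (y - of_int l * pi)" by auto
    ultimately show ?thesis unfolding eq by linarith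
  qed
qed

lemma cos_abs_primitive_add_pi: "cos_abs_primitive (x + of_int d * pi) = cos_abs_primitive x + 2 * of_int d"
proof -
  obtain k where k: "of_int k * pi - pi/2 \<le> x" "x < of_int k * pi + pi/2"
    by (rule nearest_multiple_of_pi)
  have "cos_abs_primitive (x + of_int d * pi) = 2 * of_int (k + d) + sin (x + of_int d * pi - of_int (k + d) * pi)"
    using k by (intro cos_abs_primitive_eq) (auto simp: algebra_simps)
  moreover have "cos_abs_primitive x = 2 * of_int k + sin (x - of_int k * pi)"
    using k by (intro cos_abs_primitive_eq) auto
  ultimately show ?thesis by (simp add: algebra_simps)
qed

lemma abs_sin_diff_pi: "\<bar>sin (x - of_int k * pi)\<bar> = \<bar>sin x\<bar>"
proof -
  have "sin (of_int k * pi) = 0" by (metis sin_zero_iff_int2)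
  moreover have "\<bar>cos (of_int k * pi)\<bar> = 1"
    using sin_zero_abs_cos_one calculation by blast
  ultimately show ?thesis by (simp add: sin_diff abs_mult)
qed

text \<open>Between consecutive multiples of \<open>pi/2\<close> the function \<open>|sin|\<close>
  is monotone with slope \<open>|cos|\<close> up to sign, so its increments agree in size with those
  of the primitive. Also \<open>sin\<close> does not change sign there.\<close>

lemma cos_abs_primitive_quarter:
  assumes "of_int j * (pi/2) \<le> x" "x \<le> y" "y \<le> of_int (j + 1) * (pi/2)"
  shows "cos_abs_primitive y - cos_abs_primitive x = \<bar>\<bar>sin y\<bar> - \<bar>sin x\<bar>\<bar>"
    and "0 \<le> sin x * sin y"
proof -
  have "(cos_abs_primitive y - cos_abs_primitive x = \<bar>\<bar>sin y\<bar> - \<bar>sin x\<bar>\<bar>) \<and> 0 \<le> sin x * sin y"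
  proof (cases "even j")
    case True
    then obtain k where k: "j = 2 * k" by blast
    define a b where ab: "a = x - of_int k * pi" "b = y - of_int k * pi"
    have r: "0 \<le> a" "a \<le> b" "b \<le> pi/2" using assms k by (auto simp: ab algebra_simps)
    have "cos_abs_primitive x = 2 * of_int k + sin a" "cos_abs_primitive y = 2 * of_int k + sin b"
      unfolding ab using r by (intro cos_abs_primitive_eq; simp add: ab)+
    moreover have "\<bar>sin x\<bar> = \<bar>sin a\<bar>" "\<bar>sin y\<bar> = \<bar>sin b\<bar>"
      unfolding ab by (simp_all only: abs_sin_diff_pi)
    moreover have "0 \<le> sin a" "sin a \<le> sin b"
      using r by (auto intro!: sin_ge_zero sin_monotone_2pi_le)
    moreover have "sin x * sin y = sin a * sin b * (cos (of_int k * pi))\<^sup>2"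
    proof -
      have "sin (of_int k * pi) = 0" by (metis sin_zero_iff_int2)
      moreover have "x = a + of_int k * pi" "y = b + of_int k * pi" by (auto simp: ab)
      ultimately show ?thesis by (simp add: sin_add power2_eq_square)
    qed
    ultimately show ?thesis by auto
  next
    case False
    then obtain i where "j = 2 * i + 1" by (rule oddE)
    \<comment> \<open>Quarters with even index lie to the right of \<open>k * pi\<close>, those with
      odd index to the left; \<open>a\<close> and \<open>b\<close> are offsets from
      \<open>k * pi\<close>.\<close>
    then obtain k where k: "j = 2 * k - 1" using that[of "i + 1"] by simp
    define a b where ab: "a = x - of_int k * pi" "b = y - of_int k * pi"
    have r: "-(pi/2) \<le> a" "a \<le> b" "b \<le> 0" using assms k by (auto simp: ab algebra_simps)
    have "cos_abs_primitive x = 2 * of_int k + sin a" "cos_abs_primitive y = 2 * of_int k + sin b"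
      unfolding ab using r by (intro cos_abs_primitive_eq; simp add: ab)+
    moreover have "\<bar>sin x\<bar> = \<bar>sin a\<bar>" "\<bar>sin y\<bar> = \<bar>sin b\<bar>"
      unfolding ab by (simp_all only: abs_sin_diff_pi)
    moreover have "sin b \<le> 0" "sin a \<le> sin b"
      using r sin_ge_zero[of "-b"] by (auto intro!: sin_monotone_2pi_le)
    moreover have "sin x * sin y = sin a * sin b * (cos (of_int k * pi))\<^sup>2"
    proof -
      have "sin (of_int k * pi) = 0" by (metis sin_zero_iff_int2)
      moreover have "x = a + of_int k * pi" "y = b + of_int k * pi" by (auto simp: ab)
      ultimately show ?thesis by (simp add: sin_add power2_eq_square)
    qed
    moreover have "0 \<le> sin a * sin b"
      using \<open>sin b \<le> 0\<close> \<open>sin a \<le> sin b\<close> by (intro mult_nonpos_nonpos) auto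
    ultimately show ?thesis by (auto simp del: zero_le_mult_iff)
  qed
  then show "cos_abs_primitive y - cos_abs_primitive x = \<bar>\<bar>sin y\<bar> - \<bar>sin x\<bar>\<bar>"
    and "0 \<le> sin x * sin y" by auto
qed

text \<open>Cutting the path where it crosses multiples of \<open>pi/2\<close> leaves pieces on
  which the increments of the primitive and of \<open>|sin|\<close> agree in size, and the bounds by
  \<open>A\<close> add up. The cuts prevent rises and falls of \<open>|sin|\<close> from
  cancelling.\<close>

lemma cos_abs_primitive_le_variation:
  fixes \<eta> A :: "real \<Rightarrow> real"
  assumes cont: "continuous_on {a..b} \<eta>"
    and var: "\<And>s t. \<lbrakk>a \<le> s; s \<le> t; t \<le> b\<rbrakk> \<Longrightarrow> \<bar>\<bar>sin (\<eta> t)\<bar> - \<bar>sin (\<eta> s)\<bar>\<bar> \<le> A t - A s"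
    and st: "a \<le> s" "s \<le> t" "t \<le> b"
  shows "cos_abs_primitive (\<eta> t) - cos_abs_primitive (\<eta> s) \<le> A t - A s"
proof (cases "\<eta> t \<le> \<eta> s")
  case True
  have "0 \<le> A t - A s"
    using var[OF st] by linarith
  with cos_abs_primitive_mono[OF True] show ?thesis by linarith
next
  case False
  \<comment> \<open>Induction on the number of quarters above \<open>j\<close>, splitting at the
    highest inner grid point. Only the end values of \<open>\<eta>\<close> are constrained, so
    excursions in between do no harm; continuity supplies the crossing time.\<close>
  have *: "cos_abs_primitive (\<eta> t) - cos_abs_primitive (\<eta> s) \<le> A t - A s"
    if "a \<le> s" "s \<le> t" "t \<le> b" "of_int j * (pi/2) \<le> \<eta> s" "\<eta> s \<le> \<eta> t"
       "\<eta> t \<le> of_int (j + int n) * (pi/2)" for s t j n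
    using that
  proof (induction n arbitrary: s t)
    case 0
    then have "\<eta> s = \<eta> t" by simp
    then show ?case using var[of s t] 0 by simp
  next
    case (Suc n)
    let ?c = "of_int (j + int n) * (pi/2)"
    have top: "\<eta> t \<le> of_int (j + int n + 1) * (pi/2)"
      using Suc.prems by (simp add: algebra_simps)
    consider "\<eta> t \<le> ?c" | "?c \<le> \<eta> s" | "\<eta> s \<le> ?c" "?c \<le> \<eta> t" by linarith
    then show ?case
    proof cases
      case 1
      then show ?thesis using Suc by simp
    next
      case 2
      show ?thesis
        using cos_abs_primitive_quarter(1)[OF 2 Suc.prems(5) top] var[of s t] Suc.prems by linarith
    next
      case 3
      have "continuous_on {s..t} \<eta>"
        using cont Suc.prems by (auto intro: continuous_on_subset)
      then obtain r where r: "s \<le> r" "r \<le> t" "\<eta> r = ?c"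
        using IVT'[of \<eta> s ?c t] 3 Suc.prems by auto
      have "cos_abs_primitive (\<eta> r) - cos_abs_primitive (\<eta> s) \<le> A r - A s"
        using Suc.prems r 3 by (intro Suc.IH) auto
      moreover have "cos_abs_primitive (\<eta> t) - cos_abs_primitive (\<eta> r) \<le> A t - A r"
        using cos_abs_primitive_quarter(1)[of "j + int n" "\<eta> r" "\<eta> t"] var[of r t] Suc.prems r 3 top
        by linarith
      ultimately show ?thesis by linarith
    qed
  qed
  define j where "j = \<lfloor>\<eta> s / (pi/2)\<rfloor>"
  define i where "i = \<lceil>\<eta> t / (pi/2)\<rceil>"
  have j: "of_int j * (pi/2) \<le> \<eta> s"
    using of_int_floor_le[of "\<eta> s / (pi/2)"] unfolding j_def by (subst (asm) pos_le_divide_eq) auto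
  have i: "\<eta> t \<le> of_int i * (pi/2)"
    using le_of_int_ceiling[of "\<eta> t / (pi/2)"] unfolding i_def by (subst (asm) pos_divide_le_eq) auto
  have "of_int j * (pi/2) \<le> of_int i * (pi/2)"
    using i j False by linarith
  then have "j \<le> i" by simp
  then have "i = j + int (nat (i - j))" by simp
  then show ?thesis using *[of s t j "nat (i - j)"] st i j False by simp
qed

section \<open>Circle-valued Sobolev maps, continuous lifts and the degree\<close>

lemma cis_minus_cis: "cis x - cis y = 2 * \<i> * complex_of_real (sin ((x - y)/2)) * cis ((x + y)/2)"
proof -
  define u v where "u = (x + y)/2" "v = (x - y)/2"
  then have "x = u + v" "y = u - v" by (auto simp: field_simps)
  then show ?thesis
    unfolding u_v_def[symmetric]
    by (auto simp: complex_eq_iff cos_add sin_add cos_diff sin_diff)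
qed

lemma norm_cis_diff: "norm (cis x - cis y) = 2 * \<bar>sin ((x - y)/2)\<bar>"
  by (simp add: cis_minus_cis norm_mult)

context
  fixes p F G
  assumes W: "W1p_circle p F G"
begin

lemma W1p_circle_primitive: "t \<in> {0..2*pi} \<Longrightarrow> F t = F 0 + integral {0..t} G"
  using W unfolding W1p_circle_def by blast

lemma W1p_circle_norm: "t \<in> {0..2*pi} \<Longrightarrow> norm (F t) = 1"
  using W unfolding W1p_circle_def by blast

lemma W1p_circle_integrable:
  assumes "0 \<le> s" "t \<le> 2*pi"
  shows "G absolutely_integrable_on {s..t}"
proof -
  have "G absolutely_integrable_on {0..2*pi}" using W unfolding W1p_circle_def by blast
  then show ?thesis by (rule absolutely_integrable_on_subinterval) (use assms in auto)
qed

lemma W1p_circle_powr_integrable: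
  assumes "0 \<le> s" "t \<le> 2*pi"
  shows "(\<lambda>t. norm (G t) powr p) integrable_on {s..t}"
proof -
  have "(\<lambda>t. norm (G t) powr p) integrable_on {0..2*pi}" using W unfolding W1p_circle_def by blast
  then show ?thesis by (rule integrable_on_subinterval) (use assms in auto)
qed

lemma W1p_circle_diff:
  assumes "0 \<le> s" "s \<le> t" "t \<le> 2*pi"
  shows "F t - F s = integral {s..t} G"
proof -
  have "G integrable_on {0..t}"
    using W1p_circle_integrable[of 0 t] assms by (simp add: absolutely_integrable_on_def)
  then have "integral {0..s} G + integral {s..t} G = integral {0..t} G"
    using assms by (intro Henstock_Kurzweil_Integration.integral_combine) auto
  moreover have "F t = F 0 + integral {0..t} G" "F s = F 0 + integral {0..s} G"
    using assms by (intro W1p_circle_primitive; simp)+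
  ultimately show ?thesis by (simp add: algebra_simps)
qed

lemma W1p_circle_continuous: "continuous_on {0..2*pi} F"
proof -
  have "continuous_on {0..2*pi} (\<lambda>t. F 0 + integral {0..t} G)"
    using W1p_circle_integrable[of 0 "2*pi"]
    by (intro continuous_intros indefinite_integral_continuous_1) (simp add: absolutely_integrable_on_def)
  then show ?thesis
    by (rule continuous_on_eq) (metis W1p_circle_primitive)
qed

end

text \<open>The rescaled path avoids 0 and so has a continuous logarithm. Its real part vanishes
  because the modulus is 1; its imaginary part is the angle, and the winding number measures the
  total increment.\<close>

lemma circle_path_lift:
  assumes "continuous_on {0..2*pi} F" "\<And>t. t \<in> {0..2*pi} \<Longrightarrow> norm (F t) = 1"
  obtains \<phi> :: "real \<Rightarrow> real" where "continuous_on {0..2*pi} \<phi>"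
    "\<And>t. t \<in> {0..2*pi} \<Longrightarrow> F t = cis (\<phi> t)"
    "complex_of_real (\<phi> (2*pi) - \<phi> 0) = 2 * pi * circ_deg F"
proof -
  define P where "P = (\<lambda>t. F (2*pi*t))"
  have "path P"
    unfolding P_def path_def
    by (rule continuous_on_compose2[OF assms(1)]) (auto intro!: continuous_intros)
  moreover have norm1: "norm (P t) = 1" if "t \<in> {0..1}" for t
    using that assms(2)[of "2*pi*t"] unfolding P_def by auto
  moreover from norm1 have "0 \<notin> path_image P"
    unfolding path_image_def by fastforce
  ultimately obtain q where q: "path q"
    "pathfinish q - pathstart q = 2 * of_real pi * \<i> * winding_number P 0"
    "\<And>t. t \<in> {0..1} \<Longrightarrow> P t = 0 + exp (q t)"
    by (metis winding_number_as_continuous_log)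
  have Re: "Re (q t) = 0" if "t \<in> {0..1}" for t
    using q(3)[OF that] norm1[OF that] by simp
  show ?thesis
  proof
    let ?\<phi> = "\<lambda>t. Im (q (t / (2*pi)))"
    show "continuous_on {0..2*pi} ?\<phi>"
      by (intro continuous_intros continuous_on_compose2[OF q(1)[unfolded path_def]]) auto
    show "F t = cis (?\<phi> t)" if "t \<in> {0..2*pi}" for t
      using q(3)[of "t / (2*pi)"] Re[of "t / (2*pi)"] that
      by (simp add: exp_eq_polar P_def)
    have "q 1 - q 0 = \<i> * complex_of_real (Im (q 1) - Im (q 0))"
      using Re[of 0] Re[of 1] by (simp add: complex_eq_iff)
    then have "\<i> * complex_of_real (Im (q 1) - Im (q 0)) = \<i> * (2 * pi * circ_deg F)"
      using q(2) unfolding circ_deg_def pathfinish_def pathstart_def P_def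
      by (simp add: algebra_simps)
    then show "complex_of_real (?\<phi> (2*pi) - ?\<phi> 0) = 2 * pi * circ_deg F"
      by simp
  qed
qed

text \<open>Two continuous angles of the same map differ by a continuous function with values in the
  multiples of \<open>2 * pi\<close>, hence by a constant, so their total increments agree.\<close>

lemma circ_deg_cis:
  assumes "continuous_on {0..2*pi} \<phi>" "\<phi> (2*pi) - \<phi> 0 = 2 * pi * of_int n"
  shows "circ_deg (\<lambda>t. cis (\<phi> t)) = of_int n"
proof -
  obtain \<theta> where \<theta>: "continuous_on {0..2*pi} \<theta>"
    "\<And>t. t \<in> {0..2*pi} \<Longrightarrow> cis (\<phi> t) = cis (\<theta> t)"
    "complex_of_real (\<theta> (2*pi) - \<theta> 0) = 2 * pi * circ_deg (\<lambda>t. cis (\<phi> t))"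
  proof (rule circle_path_lift[of "\<lambda>t. cis (\<phi> t)"])
    show "continuous_on {0..2*pi} (\<lambda>t. cis (\<phi> t))"
      by (intro continuous_intros assms(1))
  qed auto
  have Z: "\<exists>k::int. \<phi> t - \<theta> t = 2 * pi * of_int k" if t: "t \<in> {0..2*pi}" for t
  proof -
    have "cis (\<phi> t - \<theta> t) = 1"
      using \<theta>(2)[OF t] by (simp flip: cis_divide)
    then have "cos (\<phi> t - \<theta> t) = 1" by (simp add: complex_eq_iff)
    then show ?thesis by (auto simp: cos_one_2pi_int algebra_simps)
  qed
  have "(\<lambda>t. \<phi> t - \<theta> t) constant_on {0..2*pi}"
  proof (rule continuous_discrete_range_constant)
    show "\<exists>e>0. \<forall>s. s \<in> {0..2*pi} \<and> \<phi> s - \<theta> s \<noteq> \<phi> t - \<theta> t \<longrightarrow> e \<le> norm (\<phi> s - \<theta> s - (\<phi> t - \<theta> t))"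
      if t: "t \<in> {0..2*pi}" for t
    \<comment> \<open>Distinct multiples of \<open>2 * pi\<close> are at least \<open>2 * pi\<close>
      apart.\<close>
    proof (intro exI[of _ "2*pi"] conjI allI impI)
      fix s assume s: "s \<in> {0..2*pi} \<and> \<phi> s - \<theta> s \<noteq> \<phi> t - \<theta> t"
      obtain k l :: int where kl: "\<phi> t - \<theta> t = 2 * pi * of_int k" "\<phi> s - \<theta> s = 2 * pi * of_int l"
        using Z s t by metis
      then have "1 \<le> \<bar>l - k\<bar>" using s by auto
      then have "1 \<le> \<bar>real_of_int l - of_int k\<bar>" by linarith
      then have "2 * pi * 1 \<le> 2 * pi * \<bar>real_of_int l - of_int k\<bar>"
        by (intro mult_left_mono) auto
      then show "2*pi \<le> norm (\<phi> s - \<theta> s - (\<phi> t - \<theta> t))"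
        unfolding kl by (simp add: abs_mult flip: right_diff_distrib)
    qed auto
  qed (auto intro!: continuous_intros assms(1) \<theta>(1))
  then have "\<phi> 0 - \<theta> 0 = \<phi> (2*pi) - \<theta> (2*pi)"
    unfolding constant_on_def by auto
  then have "\<theta> (2*pi) - \<theta> 0 = 2 * pi * of_int n" using assms(2) by linarith
  then show ?thesis using \<theta>(3) by simp
qed

lemma W1p_circle_lift:
  assumes "W1p_circle p F G" "circ_deg F = of_int n"
  obtains \<phi> :: "real \<Rightarrow> real" where "continuous_on {0..2*pi} \<phi>"
    "\<And>t. t \<in> {0..2*pi} \<Longrightarrow> F t = cis (\<phi> t)" "\<phi> (2*pi) - \<phi> 0 = 2 * pi * of_int n"
proof -
  obtain \<phi> where \<phi>: "continuous_on {0..2*pi} \<phi>"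
    "\<And>t. t \<in> {0..2*pi} \<Longrightarrow> F t = cis (\<phi> t)"
    "complex_of_real (\<phi> (2*pi) - \<phi> 0) = 2 * pi * circ_deg F"
    using circle_path_lift[OF W1p_circle_continuous[OF assms(1)] W1p_circle_norm[OF assms(1)]] by metis
  have "complex_of_real (\<phi> (2*pi) - \<phi> 0) = complex_of_real (2 * pi * of_int n)"
    using \<phi>(3) assms(2) by simp
  then have "\<phi> (2*pi) - \<phi> 0 = 2 * pi * of_int n"
    by (simp only: of_real_eq_iff)
  with that \<phi> show ?thesis by blast
qed

section \<open>Integrability and arclength of the difference of two maps\<close>

lemma powr_add_le:
  fixes a b p :: real
  assumes "0 \<le> a" "0 \<le> b" "0 \<le> p"
  shows "(a + b) powr p \<le> 2 powr p * (a powr p + b powr p)"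
proof -
  have "(a + b) powr p \<le> (2 * max a b) powr p"
    using assms by (intro powr_mono2) auto
  also have "\<dots> = 2 powr p * max a b powr p"
    using assms by (simp add: powr_mult)
  also have "max a b powr p \<le> a powr p + b powr p"
    by (auto simp: max_def)
  finally show ?thesis by simp
qed

context
  fixes p F G H K
  assumes W: "W1p_circle p F G" "W1p_circle p H K"
begin

lemma W1p_circle_norm_diff_integrable:
  assumes "0 \<le> s" "t \<le> 2*pi"
  shows "(\<lambda>t. norm (G t - K t)) integrable_on {s..t}"
  using set_integral_diff(1)[OF W1p_circle_integrable[OF W(1) assms] W1p_circle_integrable[OF W(2) assms]]
  by (simp add: absolutely_integrable_on_def)

lemma W1p_circle_powr_diff_integrable:
  assumes "1 \<le> p"
  shows "(\<lambda>t. norm (G t - K t) powr p) integrable_on {0..2*pi}"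
proof (rule measurable_bounded_by_integrable_imp_integrable)
  have "(\<lambda>t. G t - K t) absolutely_integrable_on {0..2*pi}"
    using W1p_circle_integrable[OF W(1), of 0 "2*pi"] W1p_circle_integrable[OF W(2), of 0 "2*pi"]
    by (intro set_integral_diff(1)) auto
  then have "(\<lambda>t. G t - K t) \<in> borel_measurable (lebesgue_on {0..2*pi})"
    by (simp add: absolutely_integrable_measurable)
  then show "(\<lambda>t. norm (G t - K t) powr p) \<in> borel_measurable (lebesgue_on {0..2*pi})"
    by measurable
  show "(\<lambda>t. 2 powr p * (norm (G t) powr p + norm (K t) powr p)) integrable_on {0..2*pi}"
    using W1p_circle_powr_integrable[OF W(1), of 0 "2*pi"] W1p_circle_powr_integrable[OF W(2), of 0 "2*pi"]
    by (intro integrable_on_mult_right integrable_add) auto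
  show "norm (norm (G t - K t) powr p) \<le> 2 powr p * (norm (G t) powr p + norm (K t) powr p)"
    if "t \<in> {0..2*pi}" for t
  proof -
    have "norm (G t - K t) powr p \<le> (norm (G t) + norm (K t)) powr p"
      using assms by (intro powr_mono2 norm_triangle_ineq4) auto
    also have "\<dots> \<le> 2 powr p * (norm (G t) powr p + norm (K t) powr p)"
      using assms by (intro powr_add_le) auto
    finally show ?thesis by simp
  qed
qed auto

lemma W1p_circle_norm_diff_le:
  assumes "0 \<le> s" "s \<le> t" "t \<le> 2*pi"
  shows "norm ((F t - H t) - (F s - H s)) \<le> integral {s..t} (\<lambda>t. norm (G t - K t))"
proof -
  have i: "G integrable_on {s..t}" "K integrable_on {s..t}"
    using W1p_circle_integrable[OF W(1), of s t] W1p_circle_integrable[OF W(2), of s t] assms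
    by (auto simp: absolutely_integrable_on_def)
  have "(F t - H t) - (F s - H s) = integral {s..t} G - integral {s..t} K"
    using W1p_circle_diff[OF W(1) assms] W1p_circle_diff[OF W(2) assms] by (simp add: algebra_simps)
  also have "\<dots> = integral {s..t} (\<lambda>t. G t - K t)"
    using i by (simp add: Henstock_Kurzweil_Integration.integral_diff)
  also have "norm \<dots> \<le> integral {s..t} (\<lambda>t. norm (G t - K t))"
    using i assms by (intro Henstock_Kurzweil_Integration.integral_norm_bound_integral integrable_diff
      W1p_circle_norm_diff_integrable) auto
  finally show ?thesis .
qed

end

section \<open>Jensen's inequality, the optimal constant and a law of cosines\<close>

text \<open>Integrate the gap \<open>e\<close> between the power and its tangent line at
  \<open>c\<close>. The tangent has nonnegative slope, so a mean of at least \<open>c\<close>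
  suffices. In the equality case the integral of \<open>e\<close> is 0, and strict convexity makes
  \<open>g\<close> equal to \<open>c\<close> almost everywhere.\<close>

lemma integral_powr_ge:
  fixes g :: "real \<Rightarrow> real"
  assumes p: "1 \<le> p" and "a \<le> b" "0 < c"
    and nonneg: "\<And>x. x \<in> {a..b} \<Longrightarrow> 0 \<le> g x"
    and int: "g integrable_on {a..b}" "(\<lambda>x. g x powr p) integrable_on {a..b}"
    and mean: "c * (b - a) \<le> integral {a..b} g"
  shows "(b - a) * c powr p \<le> integral {a..b} (\<lambda>x. g x powr p)"
    and "\<lbrakk>1 < p; integral {a..b} (\<lambda>x. g x powr p) = (b - a) * c powr p\<rbrakk>
         \<Longrightarrow> negligible {x \<in> {a..b}. g x \<noteq> c}"
proof -
  define e where "e x = g x powr p - (c powr p + p * c powr (p - 1) * (g x - c))" for x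
  have e_nonneg: "0 \<le> e x" if "x \<in> {a..b}" for x
    using powr_tangent_le[OF p nonneg[OF that] \<open>0 < c\<close>] unfolding e_def by simp
  have g': "((\<lambda>x. g x - c) has_integral (integral {a..b} g - (b - a) * c)) {a..b}"
    using has_integral_diff[OF integrable_integral[OF int(1)] has_integral_const_real[of c a b]] \<open>a \<le> b\<close>
    by simp
  have "((\<lambda>x. c powr p + p * c powr (p - 1) * (g x - c)) has_integral
      ((b - a) * c powr p + p * c powr (p - 1) * (integral {a..b} g - (b - a) * c))) {a..b}"
    using has_integral_add[OF has_integral_const_real[of "c powr p" a b] has_integral_mult_right[OF g', of "p * c powr (p - 1)"]] \<open>a \<le> b\<close>
    by simp
  then have e_int: "(e has_integral (integral {a..b} (\<lambda>x. g x powr p) -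
      ((b - a) * c powr p + p * c powr (p - 1) * (integral {a..b} g - (b - a) * c)))) {a..b}"
    unfolding e_def by (intro has_integral_diff integrable_integral int(2))
  have slope: "0 \<le> p * c powr (p - 1) * (integral {a..b} g - (b - a) * c)"
    using p mean by (auto simp: mult.commute)
  have e_int_nonneg: "0 \<le> integral {a..b} (\<lambda>x. g x powr p) -
      ((b - a) * c powr p + p * c powr (p - 1) * (integral {a..b} g - (b - a) * c))"
    using has_integral_nonneg[OF e_int] e_nonneg by blast
  then show "(b - a) * c powr p \<le> integral {a..b} (\<lambda>x. g x powr p)"
    using slope by linarith
  show "negligible {x \<in> {a..b}. g x \<noteq> c}"
    if "1 < p" and eq: "integral {a..b} (\<lambda>x. g x powr p) = (b - a) * c powr p"
  proof -
    have "integral {a..b} e = 0"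
      using e_int_nonneg slope eq integral_unique[OF e_int] by linarith
    then have "negligible {x \<in> {a..b}. e x \<noteq> 0}"
      using e_int e_nonneg by (intro integral_zero_imp_negligible) auto
    moreover have "e x \<noteq> 0" if "x \<in> {a..b}" "g x \<noteq> c" for x
      using powr_tangent_less[OF \<open>1 < p\<close> nonneg[OF that(1)] \<open>0 < c\<close> that(2)] unfolding e_def by simp
    ultimately show ?thesis
      by (elim negligible_subset) auto
  qed
qed

text \<open>The left side is the norm of the constant speed \<open>2 * d / pi\<close>, which is the
  length \<open>4 * d\<close> spread evenly over \<open>2 * pi\<close>.\<close>

lemma optimal_value_eq:
  assumes "1 \<le> p" "0 < d"
  shows "(2 * pi * (2 * d / pi) powr p) powr (1/p) = 2 powr (1/p + 1) * pi powr (1/p - 1) * d"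
proof -
  have "(2 * pi * (2 * d / pi) powr p) powr (1/p) = 2 powr (1/p) * pi powr (1/p) * (2 * d / pi)"
    using assms by (simp add: powr_mult powr_powr)
  also have "\<dots> = 2 powr (1/p + 1) * pi powr (1/p - 1) * d"
    by (simp add: powr_add powr_diff)
  finally show ?thesis .
qed

text \<open>This law of cosines splits a chord of \<open>f - g\<close> into a radial part and a
  turning part; the latter is nonnegative when \<open>a\<close> and \<open>b\<close> have the same
  sign.\<close>

lemma norm_scaled_cis_diff_sq:
  fixes a b u v :: real
  shows "(norm (2 * \<i> * complex_of_real a * cis u - 2 * \<i> * complex_of_real b * cis v))\<^sup>2
       = 4 * ((a - b)\<^sup>2 + 2 * (a * b) * (1 - cos (u - v)))"
proof -
  have su: "(sin u)\<^sup>2 = 1 - (cos u)\<^sup>2" "(sin v)\<^sup>2 = 1 - (cos v)\<^sup>2" by (auto simp: sin_squared_eq)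
  show ?thesis
    unfolding cmod_power2 cos_diff
    by (simp add: power2_diff power_mult_distrib su algebra_simps)
qed

lemma four_sin_half_sq: "4 * (sin (x/2))\<^sup>2 = 2 * (1 - cos x)" for x :: real
  using cos_double_sin[of "x/2"] by simp

section \<open>The lower bound for a pair of maps\<close>

locale circle_pair =
  fixes p :: real and F G H K :: "real \<Rightarrow> complex" and d1 d2 :: int and \<phi> \<psi> :: "real \<Rightarrow> real"
  assumes p: "1 \<le> p"
    and W: "W1p_circle p F G" "W1p_circle p H K"
    and lift_cont: "continuous_on {0..2*pi} \<phi>" "continuous_on {0..2*pi} \<psi>"
    and lift: "\<And>t. t \<in> {0..2*pi} \<Longrightarrow> F t = cis (\<phi> t)" "\<And>t. t \<in> {0..2*pi} \<Longrightarrow> H t = cis (\<psi> t)"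
    and lift_deg: "\<phi> (2*pi) - \<phi> 0 = 2 * pi * of_int d1" "\<psi> (2*pi) - \<psi> 0 = 2 * pi * of_int d2"
    and deg_less: "d2 < d1"
begin

definition "\<eta> t = (\<phi> t - \<psi> t) / 2"
definition "m t = (\<phi> t + \<psi> t) / 2"
definition "d = real_of_int (d1 - d2)"
text \<open>The average speed over \<open>[0, 2*pi]\<close> of a curve of length
  \<open>4 * d\<close>, the lower bound for the length of \<open>f - g\<close>.\<close>

definition "c = 2 * d / pi"

lemma d_ge_1: "1 \<le> d" and c_pos: "0 < c"
proof -
  show "1 \<le> d" using deg_less unfolding d_def by linarith
  then show "0 < c" unfolding c_def by simp
qed

lemma cont_\<eta>: "continuous_on {0..2*pi} \<eta>" and cont_m: "continuous_on {0..2*pi} m"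
  unfolding \<eta>_def m_def by (intro continuous_intros lift_cont; simp)+

lemma \<eta>_end: "\<eta> (2*pi) = \<eta> 0 + d * pi" and m_end: "m (2*pi) = m 0 + of_int (d1 + d2) * pi"
  using lift_deg unfolding \<eta>_def m_def d_def by (auto simp: field_simps)

lemma diff_eq: "t \<in> {0..2*pi} \<Longrightarrow> F t - H t = 2 * \<i> * complex_of_real (sin (\<eta> t)) * cis (m t)"
  unfolding lift \<eta>_def m_def by (rule cis_minus_cis)

text \<open>The reverse triangle inequality bounds changes of the modulus
  \<open>2 * |sin \<eta>|\<close> by the arclength of \<open>f - g\<close>, and the passage from
  \<open>|sin|\<close> to the primitive of \<open>|cos|\<close> counts every rise and fall.\<close>

lemma primitive_le_integral:
  assumes st: "0 \<le> s" "s \<le> t" "t \<le> 2*pi"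
  shows "2 * cos_abs_primitive (\<eta> t) - 2 * cos_abs_primitive (\<eta> s) \<le> integral {s..t} (\<lambda>t. norm (G t - K t))"
proof -
  \<comment> \<open>Half the arclength, to match the factor 2 in the modulus of
    \<open>f - g\<close>.\<close>
  define A where "A t = integral {0..t} (\<lambda>t. norm (G t - K t)) / 2" for t
  have A: "A t - A s = integral {s..t} (\<lambda>t. norm (G t - K t)) / 2" if "0 \<le> s" "s \<le> t" "t \<le> 2*pi" for s t
    using Henstock_Kurzweil_Integration.integral_combine[OF that(1,2) W1p_circle_norm_diff_integrable[OF W, of 0 t]] that
    unfolding A_def by simp
  have "cos_abs_primitive (\<eta> t) - cos_abs_primitive (\<eta> s) \<le> A t - A s"
  proof (rule cos_abs_primitive_le_variation[OF cont_\<eta> _ st])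
    fix s t :: real assume st: "0 \<le> s" "s \<le> t" "t \<le> 2*pi"
    have n: "norm (F t - H t) = 2 * \<bar>sin (\<eta> t)\<bar>" "norm (F s - H s) = 2 * \<bar>sin (\<eta> s)\<bar>"
      using st by (simp_all add: diff_eq norm_mult)
    have "\<bar>norm (F t - H t) - norm (F s - H s)\<bar> \<le> norm ((F t - H t) - (F s - H s))"
      by (rule norm_triangle_ineq3)
    also have "\<dots> \<le> 2 * (A t - A s)"
      using W1p_circle_norm_diff_le[OF W st] A[OF st] by simp
    finally have "2 * \<bar>\<bar>sin (\<eta> t)\<bar> - \<bar>sin (\<eta> s)\<bar>\<bar> \<le> 2 * (A t - A s)"
      unfolding n right_diff_distrib[symmetric] abs_mult by simp
    then show "\<bar>\<bar>sin (\<eta> t)\<bar> - \<bar>sin (\<eta> s)\<bar>\<bar> \<le> A t - A s"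
      by simp
  qed
  then show ?thesis using A[OF st] by simp
qed

lemma primitive_end: "cos_abs_primitive (\<eta> (2*pi)) = cos_abs_primitive (\<eta> 0) + 2 * d"
  unfolding \<eta>_end d_def by (rule cos_abs_primitive_add_pi)

lemma mean_ge: "c * (2*pi - 0) \<le> integral {0..2*pi} (\<lambda>t. norm (G t - K t))"
  using primitive_le_integral[of 0 "2*pi"] primitive_end unfolding c_def by simp

lemma Lp_dist_ge: "2 powr (1/p + 1) * pi powr (1/p - 1) * d \<le> Lp_dist p G K"
proof -
  have "(2*pi - 0) * c powr p \<le> integral {0..2*pi} (\<lambda>t. norm (G t - K t) powr p)"
    using p c_pos mean_ge W1p_circle_norm_diff_integrable[OF W] W1p_circle_powr_diff_integrable[OF W p]
    by (intro integral_powr_ge) auto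
  then have "(2 * pi * c powr p) powr (1/p) \<le> Lp_dist p G K"
    unfolding Lp_dist_def using p by (intro powr_mono2) auto
  then show ?thesis
    using optimal_value_eq[OF p, of d] d_ge_1 unfolding c_def by simp
qed

section \<open>Rigidity of optimal pairs for \<open>p > 1\<close>\<close>

context
  assumes p_gt: "1 < p" and optimal: "Lp_dist p G K = 2 powr (1/p + 1) * pi powr (1/p - 1) * d"
begin

text \<open>Optimality is the equality case of Jensen's inequality, so the speed of
  \<open>f - g\<close> is \<open>c\<close> almost everywhere.\<close>

lemma integral_speed:
  assumes "0 \<le> s" "s \<le> t" "t \<le> 2*pi"
  shows "integral {s..t} (\<lambda>t. norm (G t - K t)) = c * (t - s)"
proof -
  let ?I = "integral {0..2*pi} (\<lambda>t. norm (G t - K t) powr p)"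
  have "?I powr (1/p) = (2 * pi * c powr p) powr (1/p)"
    using optimal optimal_value_eq[OF p, of d] d_ge_1 unfolding c_def Lp_dist_def by simp
  then have "(?I powr (1/p)) powr p = ((2 * pi * c powr p) powr (1/p)) powr p"
    by simp
  moreover have "0 \<le> ?I"
    by (intro Henstock_Kurzweil_Integration.integral_nonneg W1p_circle_powr_diff_integrable[OF W p]) auto
  ultimately have "?I = (2*pi - 0) * c powr p"
    using p_gt by (simp add: powr_powr)
  then have neg: "negligible {t \<in> {0..2*pi}. norm (G t - K t) \<noteq> c}"
    using p p_gt c_pos mean_ge W1p_circle_norm_diff_integrable[OF W] W1p_circle_powr_diff_integrable[OF W p]
    by (intro integral_powr_ge(2)[of p]) auto
  have "integral {s..t} (\<lambda>t. norm (G t - K t)) = integral {s..t} (\<lambda>t. c)"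
    by (rule integral_spike[OF neg]) (use assms in auto)
  then show ?thesis using assms by simp
qed

text \<open>The bounds on \<open>{0..s}\<close>, \<open>{s..t}\<close> and \<open>{t..2*pi}\<close> add up to an equality, so each is one.\<close>

lemma primitive_linear:
  assumes "0 \<le> s" "s \<le> t" "t \<le> 2*pi"
  shows "2 * cos_abs_primitive (\<eta> t) - 2 * cos_abs_primitive (\<eta> s) = c * (t - s)"
proof -
  have b: "2 * cos_abs_primitive (\<eta> t) - 2 * cos_abs_primitive (\<eta> s) \<le> c * (t - s)"
    if "0 \<le> s" "s \<le> t" "t \<le> 2*pi" for s t
    using primitive_le_integral[OF that] integral_speed[OF that] by simp
  have "2 * cos_abs_primitive (\<eta> (2*pi)) - 2 * cos_abs_primitive (\<eta> 0) = c * (2*pi)"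
    unfolding primitive_end c_def by simp
  moreover have "c * (2*pi) = c * (2*pi - t) + c * (t - s) + c * (s - 0)"
    by (simp add: algebra_simps)
  moreover have "2 * cos_abs_primitive (\<eta> s) - 2 * cos_abs_primitive (\<eta> 0) \<le> c * (s - 0)"
    "2 * cos_abs_primitive (\<eta> (2*pi)) - 2 * cos_abs_primitive (\<eta> t) \<le> c * (2*pi - t)"
    using assms by (intro b; simp)+
  moreover note b[OF assms]
  moreover define u v w where "u = c * (2*pi - t)" "v = c * (t - s)" "w = c * (s - 0)"
  ultimately show ?thesis
    unfolding u_v_w_def[symmetric] by linarith
qed

text \<open>The primitive is monotone and grows strictly along \<open>\<eta>\<close>, so
  \<open>\<eta>\<close> itself cannot stall or turn back.\<close>

lemma \<eta>_strict_mono: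
  assumes "0 \<le> s" "s < t" "t \<le> 2*pi"
  shows "\<eta> s < \<eta> t"
proof (rule ccontr)
  assume "\<not> \<eta> s < \<eta> t"
  then have "cos_abs_primitive (\<eta> t) \<le> cos_abs_primitive (\<eta> s)"
    by (intro cos_abs_primitive_mono) simp
  moreover have "0 < c * (t - s)" using c_pos assms by simp
  moreover have "2 * cos_abs_primitive (\<eta> t) - 2 * cos_abs_primitive (\<eta> s) = c * (t - s)"
    using assms by (intro primitive_linear) auto
  moreover define u where "u = c * (t - s)"
  ultimately show False unfolding u_def[symmetric] by linarith
qed

lemma \<eta>_mono:
  assumes "0 \<le> s" "s \<le> t" "t \<le> 2*pi"
  shows "\<eta> s \<le> \<eta> t"
  using \<eta>_strict_mono[of s t] assms by (cases "s = t") auto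

text \<open>Within one open quarter the arclength \<open>c * (t - s)\<close> equals the change of
  modulus of \<open>f - g\<close>. The chord is no longer than the arc, so it is purely radial; as
  the two sines have the same nonzero sign, the turning term must vanish.\<close>

lemma cos_m_diff:
  assumes "0 \<le> s" "s \<le> t" "t \<le> 2*pi"
    and "of_int j * (pi/2) < \<eta> s" "\<eta> t < of_int (j + 1) * (pi/2)"
  shows "cos (m t - m s) = 1"
proof -
  have q: "of_int j * (pi/2) \<le> \<eta> s" "\<eta> s \<le> \<eta> t" "\<eta> t \<le> of_int (j + 1) * (pi/2)"
    using assms \<eta>_mono[of s t] by auto
  \<comment> \<open>Zeros of \<open>sin\<close> are the even multiples of \<open>pi/2\<close>, and
    none lies strictly between consecutive multiples.\<close>
  have nz: "sin x \<noteq> 0" if x: "of_int j * (pi/2) < x" "x < of_int (j + 1) * (pi/2)" for x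
  proof
    assume "sin x = 0"
    then obtain i where "x = of_int i * pi" by (auto simp: sin_zero_iff_int2)
    then have "of_int j * (pi/2) < of_int (2*i) * (pi/2)" "of_int (2*i) * (pi/2) < of_int (j + 1) * (pi/2)"
      using x by auto
    then have "j < 2 * i" "2 * i < j + 1" by (simp_all only: mult_less_cancel_right of_int_less_iff) auto
    then show False by linarith
  qed
  have "sin (\<eta> s) \<noteq> 0" "sin (\<eta> t) \<noteq> 0" using assms q by (intro nz; linarith)+
  with cos_abs_primitive_quarter(2)[OF q] have pos: "0 < sin (\<eta> t) * sin (\<eta> s)"
    by (simp add: less_le mult.commute)
  have "(norm ((F t - H t) - (F s - H s)))\<^sup>2 \<le> (c * (t - s))\<^sup>2"
    using W1p_circle_norm_diff_le[OF W, of s t] integral_speed[of s t] assms by (intro power_mono) auto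
  also have "\<dots> = 4 * (\<bar>sin (\<eta> t)\<bar> - \<bar>sin (\<eta> s)\<bar>)\<^sup>2"
    unfolding primitive_linear[OF assms(1-3), symmetric] right_diff_distrib[symmetric]
      cos_abs_primitive_quarter(1)[OF q]
    by (simp add: power_mult_distrib)
  also have "(\<bar>sin (\<eta> t)\<bar> - \<bar>sin (\<eta> s)\<bar>)\<^sup>2 = (sin (\<eta> t) - sin (\<eta> s))\<^sup>2"
    using pos by (simp add: power2_diff flip: abs_mult)
  finally have "2 * (sin (\<eta> t) * sin (\<eta> s)) * (1 - cos (m t - m s)) \<le> 0"
    using assms by (simp add: diff_eq norm_scaled_cis_diff_sq)
  then have "1 - cos (m t - m s) \<le> 0"
    using mult_pos_pos[OF pos, of "1 - cos (m t - m s)"] by (simp only: mult.assoc) linarith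
  then show ?thesis using cos_le_one[of "m t - m s"] by linarith
qed

text \<open>Strict monotonicity makes \<open>\<eta>\<close> injective, and its range meets only
  finitely many multiples of \<open>pi/2\<close>. These times form the exceptional set when
  \<open>m\<close> is integrated.\<close>

lemma finite_quarters: "finite {t \<in> {0..2*pi}. \<exists>j::int. \<eta> t = of_int j * (pi/2)}" (is "finite ?E")
proof (rule finite_imageD)
  show "inj_on \<eta> ?E"
    by (rule linorder_inj_onI') (use \<eta>_strict_mono in fastforce)
  have "\<eta> ` ?E \<subseteq> (\<lambda>j. of_int j * (pi/2)) ` {\<lfloor>\<eta> 0 / (pi/2)\<rfloor>..\<lceil>\<eta> (2*pi) / (pi/2)\<rceil>}"
  proof
    fix x assume "x \<in> \<eta> ` ?E"
    then obtain t j where t: "t \<in> {0..2*pi}" "x = \<eta> t" "\<eta> t = of_int j * (pi/2)" by blast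
    have "\<eta> 0 \<le> of_int j * (pi/2)" "of_int j * (pi/2) \<le> \<eta> (2*pi)"
      using \<eta>_mono[of 0 t] \<eta>_mono[of t "2*pi"] t by auto
    then have "\<eta> 0 / (pi/2) \<le> of_int j" "of_int j \<le> \<eta> (2*pi) / (pi/2)"
      by (subst pos_divide_le_eq pos_le_divide_eq; simp)+
    then have "\<lfloor>\<eta> 0 / (pi/2)\<rfloor> \<le> j" "j \<le> \<lceil>\<eta> (2*pi) / (pi/2)\<rceil>" by linarith+
    then show "x \<in> (\<lambda>j. of_int j * (pi/2)) ` {\<lfloor>\<eta> 0 / (pi/2)\<rfloor>..\<lceil>\<eta> (2*pi) / (pi/2)\<rceil>}"
      using t by auto
  qed
  then show "finite (\<eta> ` ?E)" by (rule finite_subset) auto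
qed

text \<open>Near \<open>t\<close> the angle \<open>\<eta>\<close> stays in one open quarter, so
  \<open>m\<close> changes only by multiples of \<open>2 * pi\<close>; by continuity the change is
  below \<open>pi\<close>, hence 0.\<close>

lemma m_locally_constant:
  assumes t: "0 < t" "t < 2*pi" and "\<nexists>j::int. \<eta> t = of_int j * (pi/2)"
  shows "(m has_vector_derivative 0) (at t)"
proof -
  define j where "j = \<lfloor>\<eta> t / (pi/2)\<rfloor>"
  have "of_int j \<le> \<eta> t / (pi/2)" "\<eta> t / (pi/2) < of_int (j + 1)"
    unfolding j_def by linarith+
  moreover have "0 < pi/2" by simp
  ultimately have "of_int j * (pi/2) \<le> \<eta> t" "\<eta> t < of_int (j + 1) * (pi/2)"
    using pos_le_divide_eq pos_divide_less_eq by blast+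
  moreover have "\<eta> t \<noteq> of_int j * (pi/2)"
  proof
    assume "\<eta> t = of_int j * (pi/2)"
    then have "\<exists>j::int. \<eta> t = of_int j * (pi/2)" by (rule exI)
    with assms(3) show False by (rule notE)
  qed
  ultimately have j: "of_int j * (pi/2) < \<eta> t" "\<eta> t < of_int (j + 1) * (pi/2)"
    by (auto intro!: le_neq_trans)
  have t': "t \<in> interior {0..2*pi}" using t by simp
  have "isCont \<eta> t" "isCont m t"
    using continuous_on_interior[OF cont_\<eta> t'] continuous_on_interior[OF cont_m t'] by auto
  then have lim: "(\<eta> \<longlongrightarrow> \<eta> t) (nhds t)" "(m \<longlongrightarrow> m t) (nhds t)"
    by (simp_all add: isCont_def tendsto_at_iff_tendsto_nhds)
  note order_tendstoD(1)[OF lim(1) j(1)] order_tendstoD(2)[OF lim(1) j(2)] tendstoD[OF lim(2) pi_gt_zero]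
  moreover have "\<forall>\<^sub>F s in nhds t. s \<in> {0<..<2*pi}"
    using t by (intro eventually_nhds_in_open) auto
  ultimately have "\<forall>\<^sub>F s in nhds t. m t = m s"
  proof eventually_elim
    case (elim s)
    have "cos (m t - m s) = 1"
    proof (cases "s \<le> t")
      case True
      then show ?thesis using elim j t by (intro cos_m_diff) auto
    next
      case False
      then have "cos (m s - m t) = 1" using elim j t by (intro cos_m_diff) auto
      then show ?thesis by (metis cos_minus minus_diff_eq)
    qed
    then obtain i :: int where i: "m t - m s = of_int i * 2 * pi"
      by (auto simp: cos_one_2pi_int)
    have "\<bar>m t - m s\<bar> < pi"
      using elim(3) by (simp add: dist_real_def abs_minus_commute)
    then have "\<bar>of_int i * 2\<bar> * pi < 1 * pi"
      unfolding i by (simp add: abs_mult)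
    then have "\<bar>real_of_int i * 2\<bar> < 1"
      by (simp only: mult_less_cancel_right) auto
    then have "i = 0" by linarith
    then show ?case using i by simp
  qed
  then show ?thesis
    using DERIV_cong_ev[of t t "\<lambda>_. m t" m 0 0]
    by (simp flip: has_real_derivative_iff_has_vector_derivative)
qed

text \<open>A continuous function with zero derivative off a finite set is constant.\<close>

lemma m_constant:
  assumes "t \<in> {0..2*pi}"
  shows "m t = m 0"
proof -
  have "((\<lambda>x. 0) has_integral (m t - m 0)) {0..t}"
  proof (rule fundamental_theorem_of_calculus_interior_strong[OF finite_quarters])
    show "continuous_on {0..t} m"
      using cont_m assms by (auto intro: continuous_on_subset)
    show "(m has_vector_derivative 0) (at x)"
      if "x \<in> {0<..<t} - {t \<in> {0..2*pi}. \<exists>j::int. \<eta> t = of_int j * (pi/2)}" for x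
      using that assms by (intro m_locally_constant) auto
  qed (use assms in auto)
  then show ?thesis
    using has_integral_unique[OF _ has_integral_0[of "{0..t}"]] by fastforce
qed

lemma optimal_imp_opposite: "d2 = - d1"
proof -
  have "of_int (d1 + d2) * pi = 0"
    using m_constant[of "2*pi"] m_end by simp
  then have "d1 + d2 = 0"
    by (simp only: mult_eq_0_iff of_int_eq_0_iff) auto
  then show ?thesis by linarith
qed

text \<open>Where \<open>\<eta>\<close> reaches an odd multiple of \<open>pi/2\<close>, its sine grows linearly to an extremum, so the phase has a
  square root singularity there and \<open>|G|\<^sup>2\<close> is not integrable.\<close>

lemma optimal_imp_less_2: "p < 2"
proof (rule ccontr)
  assume "\<not> p < 2"
  then have p2: "2 \<le> p" by simp
  obtain k where k: "of_int k * pi - pi/2 \<le> \<eta> 0" "\<eta> 0 < of_int k * pi + pi/2"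
    by (rule nearest_multiple_of_pi)
  \<comment> \<open>The total rise of \<open>\<eta>\<close> is at least \<open>pi\<close>, so it
    reaches the next odd multiple of \<open>pi/2\<close>, at a time that is positive because
    \<open>\<eta> 0\<close> lies strictly below.\<close>
  have "1 * pi \<le> d * pi" using d_ge_1 by (intro mult_right_mono) auto
  then have "of_int k * pi + pi/2 \<le> \<eta> (2*pi)" using \<eta>_end k by linarith
  then obtain t0 where t0: "0 \<le> t0" "t0 \<le> 2*pi" "\<eta> t0 = of_int k * pi + pi/2"
    using IVT'[of \<eta> 0 "of_int k * pi + pi/2" "2*pi"] k cont_\<eta> by auto
  with k have "0 < t0" by (cases "t0 = 0") auto
  \<comment> \<open>With \<open>m\<close> constant the chord depends on \<open>\<eta>\<close> alone,
    and its square is exactly an increment of twice the primitive, which is linear in time.\<close>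
  have sq: "(norm (F t0 - F t))\<^sup>2 = c * (t0 - t)" if t: "0 \<le> t" "t \<le> t0" for t
  proof -
    have "of_int k * pi - pi/2 \<le> \<eta> t" "\<eta> t \<le> of_int k * pi + pi/2"
      using \<eta>_mono[of 0 t] \<eta>_mono[of t t0] t t0 k by auto
    then have S: "cos_abs_primitive (\<eta> t) = 2 * of_int k + sin (\<eta> t - of_int k * pi)"
      by (rule cos_abs_primitive_eq)
    have S0: "cos_abs_primitive (\<eta> t0) = 2 * of_int k + sin (\<eta> t0 - of_int k * pi)"
      using t0 by (intro cos_abs_primitive_eq) auto
    have "\<phi> t0 - \<phi> t = \<eta> t0 - \<eta> t + (m t0 - m t)"
      unfolding \<eta>_def m_def by (simp add: field_simps)
    also have "m t0 - m t = 0" using m_constant[of t0] m_constant[of t] t t0 by auto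
    finally have e: "\<phi> t0 - \<phi> t = \<eta> t0 - \<eta> t" by simp
    have "(norm (F t0 - F t))\<^sup>2 = 4 * (sin ((\<eta> t0 - \<eta> t)/2))\<^sup>2"
      using t t0 by (simp add: lift norm_cis_diff e power_mult_distrib)
    also have "\<dots> = 2 * (1 - cos (\<eta> t0 - \<eta> t))"
      by (rule four_sin_half_sq)
    also have "\<eta> t0 - \<eta> t = pi/2 - (\<eta> t - of_int k * pi)" using t0 by simp
    also have "cos \<dots> = sin (\<eta> t - of_int k * pi)" by (simp add: cos_diff)
    also have "2 * (1 - sin (\<eta> t - of_int k * pi)) = 2 * cos_abs_primitive (\<eta> t0) - 2 * cos_abs_primitive (\<eta> t)"
      unfolding S S0 using t0(3) by simp
    also have "\<dots> = c * (t0 - t)" using t t0 by (intro primitive_linear) auto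
    finally show ?thesis .
  qed
  \<comment> \<open>Since \<open>p\<close> is at least 2, \<open>g\<close> dominates the square of
    the speed; the summand 1 covers speeds below 1.\<close>
  define g where "g t = 1 + norm (G t) powr p" for t
  have g_int: "g integrable_on {s..t}" if "0 \<le> s" "t \<le> 2*pi" for s t
    unfolding g_def using W1p_circle_powr_integrable[OF W(1) that]
    by (intro integrable_add integrable_const_ivl) auto
  \<comment> \<open>Cauchy-Schwarz turns the square root growth into a lower bound independent of
    the length of the interval, contradicting continuity of the integral at
    \<open>t0\<close>.\<close>
  have ge: "c \<le> integral {t..t0} g" if t: "0 \<le> t" "t < t0" for t
  proof -
    define h where "h = t0 - t"
    have h: "0 < h" using t unfolding h_def by simp
    \<comment> \<open>The chord is \<open>\<nu> * h\<close>, so \<open>\<nu>\<close> is the mean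
      displacement rate; it is the optimal weight in
      \<open>2 * \<nu> * |G| \<le> |G|^2 + \<nu>^2\<close>.\<close>
    define \<nu> where "\<nu> = sqrt (c / h)"
    have \<nu>: "0 < \<nu>" "\<nu>\<^sup>2 * h = c" unfolding \<nu>_def using h c_pos by simp_all
    have G_int: "G integrable_on {t..t0}"
      using W1p_circle_integrable[OF W(1), of t t0] t t0 by (auto simp: absolutely_integrable_on_def)
    have bound: "norm (G x) \<le> g x / (2 * \<nu>) + \<nu> / 2" for x
    proof -
      have "(norm (G x))\<^sup>2 \<le> g x"
      proof (cases "norm (G x) \<le> 1")
        case True
        then have "(norm (G x))\<^sup>2 \<le> 1" by (simp add: power_le_one)
        then show ?thesis unfolding g_def by (simp add: add_increasing2)
      next
        case False
        then have "norm (G x) powr 2 \<le> norm (G x) powr p" using p2 by (intro powr_mono) auto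
        then show ?thesis unfolding g_def using False by simp
      qed
      moreover have "2 * \<nu> * norm (G x) \<le> (norm (G x))\<^sup>2 + \<nu>\<^sup>2"
        using sum_squares_bound[of \<nu> "norm (G x)"] by (simp add: power2_eq_square algebra_simps)
      ultimately have "2 * \<nu> * norm (G x) \<le> g x + \<nu>\<^sup>2" by linarith
      then show ?thesis using \<nu>(1) by (simp add: field_simps power2_eq_square)
    qed
    have "c * h = (norm (F t0 - F t))\<^sup>2" using sq[of t] t unfolding h_def by simp
    also have "norm (F t0 - F t) = norm (integral {t..t0} G)"
      using W1p_circle_diff[OF W(1), of t t0] t t0 by simp
    finally have "(\<nu> * h)\<^sup>2 = (norm (integral {t..t0} G))\<^sup>2"
      unfolding \<nu>(2)[symmetric] by (simp add: power_mult_distrib power2_eq_square mult_ac)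
    then have "\<nu> * h = norm (integral {t..t0} G)"
      using \<nu>(1) h by simp
    also have "\<dots> \<le> integral {t..t0} (\<lambda>x. g x / (2 * \<nu>) + \<nu> / 2)"
      using t t0 by (intro Henstock_Kurzweil_Integration.integral_norm_bound_integral G_int bound
          integrable_add integrable_on_divide g_int integrable_const_ivl) auto
    also have "\<dots> = integral {t..t0} g / (2 * \<nu>) + h * (\<nu> / 2)"
      using t t0 g_int[of t t0] unfolding h_def
      by (subst Henstock_Kurzweil_Integration.integral_add) (auto intro!: integrable_on_divide)
    finally have "\<nu>\<^sup>2 * h \<le> integral {t..t0} g"
      using \<nu>(1) by (simp add: field_simps power2_eq_square)
    then show ?thesis using \<nu>(2) by simp
  qed
  obtain \<delta> where \<delta>: "\<delta> > 0"
    "\<forall>t. t0 - \<delta> < t \<and> t \<le> t0 \<longrightarrow> norm (integral {0..t0} g - integral {0..t} g) < c"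
    using indefinite_integral_continuous_left[OF g_int[of 0 "2*pi"] \<open>0 < t0\<close> t0(2) c_pos] by auto
  define t where "t = max 0 (t0 - \<delta>/2)"
  have t: "0 \<le> t" "t < t0" "t0 - \<delta> < t" using \<delta>(1) \<open>0 < t0\<close> unfolding t_def by auto
  have "integral {0..t} g + integral {t..t0} g = integral {0..t0} g"
    using t t0 by (intro Henstock_Kurzweil_Integration.integral_combine g_int) auto
  moreover have "norm (integral {0..t0} g - integral {0..t} g) < c"
    using \<delta>(2) t by auto
  ultimately show False using ge[OF t(1,2)] by simp
qed

end

end

section \<open>Stair-shaped angles: integrability, slope and speed\<close>

text \<open>For \<open>l < 1\<close> the integrand is continuous. For \<open>l = 1\<close> it
  behaves at each endpoint like a power of the distance with exponent \<open>-q/2\<close>, which is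
  integrable when \<open>q < 2\<close>.\<close>

lemma integrable_inverse_sqrt_powr:
  fixes l q :: real
  assumes l: "0 < l" "l \<le> 1" and q: "0 \<le> q" and lq: "l < 1 \<or> q < 2"
  shows "(\<lambda>x. (1 / sqrt (1 - (l * x)\<^sup>2)) powr q) integrable_on {-1..1}"
proof (cases "l < 1")
  case True
  have pos: "0 < 1 - (l * x)\<^sup>2" if "x \<in> {-1..1}" for x
  proof -
    have "\<bar>l * x\<bar> \<le> l * 1" unfolding abs_mult using l that by (intro mult_mono) auto
    then have "\<bar>l * x\<bar> < 1" using True by simp
    then have "(l * x)\<^sup>2 < 1" by (simp add: abs_square_less_1)
    then show ?thesis by simp
  qed
  then show ?thesis
    by (intro integrable_continuous_interval continuous_intros) (auto simp: less_imp_neq[symmetric])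
next
  case False
  then have l1: "l = 1" and q2: "q < 2" using l lq by auto
  have a: "(\<lambda>x::real. x powr (-q/2)) integrable_on {0..2}"
    using q2 by (intro integrable_on_powr_from_0) auto
  then obtain I where "((\<lambda>x::real. x powr (-q/2)) has_integral I) (cbox 0 2)" by auto
  from has_integral_affinity'[OF this, of 1 1]
  have b: "(\<lambda>x::real. (x + 1) powr (-q/2)) integrable_on {-1..1}" by auto
  then have c: "(\<lambda>x::real. (- x + 1) powr (-q/2)) integrable_on {-1..1}"
    using Henstock_Kurzweil_Integration.integrable_reflect_real[of "\<lambda>x::real. (x + 1) powr (-q/2)" 1 "-1"]
    by simp
  show ?thesis
  proof (rule measurable_bounded_by_integrable_imp_integrable)
    show "(\<lambda>x. (1 / sqrt (1 - (l * x)\<^sup>2)) powr q) \<in> borel_measurable (lebesgue_on {-1..1})"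
      by (intro measurable_restrict_space1 measurable_completion) auto
    show "(\<lambda>x. (x + 1) powr (-q/2) + (- x + 1) powr (-q/2)) integrable_on {-1..1}"
      by (intro integrable_add b c)
    show "norm ((1 / sqrt (1 - (l * x)\<^sup>2)) powr q) \<le> (x + 1) powr (-q/2) + (- x + 1) powr (-q/2)"
      if x: "x \<in> {-1..1}" for x
    \<comment> \<open>At the endpoints division by zero makes the left side 0.\<close>
    proof (cases "\<bar>x\<bar> = 1")
      case True
      then have "x\<^sup>2 = 1" using power2_abs[of x] by simp
      then show ?thesis using l1 by simp
    next
      case False
      then have x: "-1 < x" "x < 1" using x by auto
      have "1 - x\<^sup>2 = (x + 1) * (- x + 1)" by (simp add: power2_eq_square algebra_simps)
      moreover have sq: "x\<^sup>2 < 1" using x by (simp add: abs_square_less_1 abs_less_iff)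
      moreover have "(1 / sqrt (1 - x\<^sup>2)) powr q = (1 - x\<^sup>2) powr (-q/2)"
      proof -
        have "1 / sqrt (1 - x\<^sup>2) = (1 - x\<^sup>2) powr (-1/2)"
          using sq by (simp add: powr_minus_divide powr_half_sqrt)
        then show ?thesis by (simp add: powr_powr)
      qed
      ultimately have e: "norm ((1 / sqrt (1 - (l * x)\<^sup>2)) powr q) = ((x + 1) * (- x + 1)) powr (-q/2)"
        using l1 by simp
      \<comment> \<open>On each half one factor is at least 1, and dropping it can only increase a
        nonpositive power.\<close>
      show ?thesis
      proof (cases "0 \<le> x")
        case True
        have "((x + 1) * (- x + 1)) powr (-q/2) \<le> (1 * (- x + 1)) powr (-q/2)"
          using x True q by (intro powr_mono2' mult_right_mono) auto
        then show ?thesis unfolding e by (simp add: add_increasing)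
      next
        case False
        have "((x + 1) * (- x + 1)) powr (-q/2) \<le> ((x + 1) * 1) powr (-q/2)"
          using x False q by (intro powr_mono2' mult_left_mono) auto
        then show ?thesis unfolding e by (simp add: add_increasing2)
      qed
    qed
  qed auto
qed

text \<open>For \<open>l = 1\<close> this is the inverse of \<open>cos_abs_primitive\<close>, whose derivative is unbounded near the odd
  integers; \<open>l < 1\<close> gives a Lipschitz approximation of it. At \<open>l = 1\<close> and an odd integer the derivative
  below has the junk value 0.\<close>

definition arc_stair :: "real \<Rightarrow> real \<Rightarrow> real" where
  "arc_stair l u = (let k = \<lfloor>(u + 1) / 2\<rfloor> in of_int k * pi + pi / 2 / arcsin l * arcsin (l * (u - 2 * of_int k)))"

definition arc_stair_deriv :: "real \<Rightarrow> real \<Rightarrow> real" where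
  "arc_stair_deriv l u = (let k = \<lfloor>(u + 1) / 2\<rfloor> in
     pi / 2 * l / arcsin l * (1 / sqrt (1 - (l * (u - 2 * of_int k))\<^sup>2)))"

lemma nearest_even:
  obtains k :: int where "2 * of_int k - 1 \<le> u" "u < 2 * of_int k + (1::real)"
proof
  have "of_int \<lfloor>(u + 1) / 2\<rfloor> \<le> (u + 1) / 2" "(u + 1) / 2 < of_int \<lfloor>(u + 1) / 2\<rfloor> + 1"
    by linarith+
  then have "of_int \<lfloor>(u + 1) / 2\<rfloor> * 2 \<le> u + 1" "u + 1 < (of_int \<lfloor>(u + 1) / 2\<rfloor> + 1) * 2"
    by (simp_all only: pos_le_divide_eq pos_divide_less_eq zero_less_numeral)
  then show "2 * of_int \<lfloor>(u + 1) / 2\<rfloor> - 1 \<le> u" "u < 2 * of_int \<lfloor>(u + 1) / 2\<rfloor> + 1"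
    by (auto simp: algebra_simps)
qed

context
  fixes l :: real
  assumes l: "0 < l" "l \<le> 1"
begin

lemma arcsin_l: "0 < arcsin l" "arcsin l \<le> pi/2"
  using l arcsin_less_arcsin[of 0 l] arcsin_ubound[of l] by auto

text \<open>The factor \<open>pi / 2 / arcsin l\<close> makes every step rise by exactly
  \<open>pi\<close>, so neighbouring steps match at odd integers. The slopes match there because the
  offset is squared.\<close>

lemma arc_stair_eq:
  assumes "2 * of_int k - 1 \<le> u" "u \<le> 2 * of_int k + 1"
  shows "arc_stair l u = of_int k * pi + pi / 2 / arcsin l * arcsin (l * (u - 2 * of_int k))" (is ?A)
    and "arc_stair_deriv l u = pi / 2 * l / arcsin l * (1 / sqrt (1 - (l * (u - 2 * of_int k))\<^sup>2))" (is ?B)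
proof -
  have "?A \<and> ?B"
  proof (cases "u = 2 * of_int k + 1")
    case True
    then have "(u + 1) / 2 = of_int (k + 1)" by simp
    then have *: "\<lfloor>(u + 1) / 2\<rfloor> = k + 1" by (simp only: floor_of_int)
    have e: "u - 2 * of_int (k + 1) = -1" "u - 2 * of_int k = 1" using True by auto
    show ?thesis
      unfolding arc_stair_def arc_stair_deriv_def Let_def * e
      using arcsin_l l by (simp add: arcsin_minus algebra_simps)
  next
    case False
    then have "\<lfloor>(u + 1) / 2\<rfloor> = k"
      using assms by (intro floor_unique) auto
    then show ?thesis unfolding arc_stair_def arc_stair_deriv_def Let_def by simp
  qed
  then show ?A ?B by auto
qed

lemma arc_stair_0: "arc_stair l 0 = 0"
  using arc_stair_eq(1)[of 0 0] by simp

lemma arc_stair_even: "arc_stair l (2 * of_nat n) = of_nat n * pi"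
  using arc_stair_eq(1)[of "int n" "2 * of_nat n"] by simp

lemma abs_arg_le:
  assumes "2 * of_int k - 1 \<le> u" "u \<le> 2 * of_int k + 1"
  shows "\<bar>l * (u - 2 * of_int k)\<bar> \<le> l"
proof -
  have "l * \<bar>u - 2 * of_int k\<bar> \<le> l * 1"
    using l assms by (intro mult_left_mono) auto
  then show ?thesis using l by (simp add: abs_mult)
qed

lemma continuous_on_arc_stair: "continuous_on {-1..2 * real n + 1} (arc_stair l)"
proof (induction n)
  have piece: "continuous_on {2 * of_int k - 1..2 * of_int k + 1} (arc_stair l)" for k :: int
  proof -
    have "continuous_on {2 * of_int k - 1..2 * of_int k + 1}
        (\<lambda>u. of_int k * pi + pi / 2 / arcsin l * arcsin (l * (u - 2 * of_int k)))"
    proof (intro continuous_intros ballI)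
      fix u assume "u \<in> {2 * real_of_int k - 1..2 * of_int k + 1}"
      then show "-1 \<le> l * (u - 2 * of_int k) \<and> l * (u - 2 * of_int k) \<le> 1"
        using abs_arg_le[of k u] l by auto
    qed
    then show ?thesis
      by (rule continuous_on_eq) (rule arc_stair_eq(1)[of k, symmetric]; simp)
  qed
  case 0
  show ?case using piece[of 0] by simp
  case (Suc n)
  have "{-1..2 * real (Suc n) + 1} = {-1..2 * real n + 1} \<union> {2 * real n + 1..2 * real (Suc n) + 1}"
    by auto
  moreover have "continuous_on {2 * real n + 1..2 * real (Suc n) + 1} (arc_stair l)"
    using piece[of "int (Suc n)"] by (simp add: algebra_simps)
  ultimately show ?case
    using Suc by (simp only:) (intro continuous_on_closed_Un; simp)
qed

lemma arc_stair_has_derivative: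
  assumes "2 * of_int k - 1 < u" "u < 2 * of_int k + 1"
  shows "(arc_stair l has_real_derivative arc_stair_deriv l u) (at u)"
proof -
  have "l * \<bar>u - 2 * of_int k\<bar> < l * 1"
    using l assms by (intro mult_strict_left_mono) auto
  then have "\<bar>l * (u - 2 * of_int k)\<bar> < 1" using l(2) unfolding abs_mult abs_of_pos[OF l(1)] by linarith
  then have b: "-1 < l * (u - 2 * of_int k)" "l * (u - 2 * of_int k) < 1" by (auto simp: abs_less_iff)
  have "((\<lambda>u. of_int k * pi + pi / 2 / arcsin l * arcsin (l * (u - 2 * of_int k)))
      has_real_derivative arc_stair_deriv l u) (at u)"
    using assms b arcsin_l
    by (auto intro!: derivative_eq_intros simp: arc_stair_eq(2)[of k] field_simps)
  then show ?thesis
    by (rule has_field_derivative_transform_within_open[of _ _ _ "{2 * of_int k - 1<..<2 * of_int k + 1}"])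
       (use assms in \<open>auto simp: arc_stair_eq(1)[of k]\<close>)
qed

lemma arc_stair_deriv_nonneg: "0 \<le> arc_stair_deriv l u"
proof -
  obtain k where "2 * of_int k - 1 \<le> u" "u < 2 * of_int k + 1" by (rule nearest_even)
  moreover from this have "(l * (u - 2 * of_int k))\<^sup>2 \<le> 1"
    using abs_arg_le[of k u] l by (simp add: abs_square_le_1)
  ultimately show ?thesis using arcsin_l l by (simp add: arc_stair_eq(2)[of k])
qed

text \<open>Stretching \<open>arcsin y\<close> by a factor of at least 1 within
  \<open>[-pi/2, pi/2]\<close> lowers its cosine, so \<open>cos A \<le> sqrt (1 - y^2)\<close>,
  which cancels the singular factor of the slope. This product is half the speed of
  \<open>f - g\<close>, per unit of \<open>u\<close>, while \<open>m\<close> rests.\<close>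

lemma arc_stair_speed_le: "arc_stair_deriv l u * \<bar>cos (arc_stair l u)\<bar> \<le> pi / 2 * l / arcsin l"
proof -
  obtain k where k: "2 * of_int k - 1 \<le> u" "u < 2 * of_int k + 1" by (rule nearest_even)
  define y where "y = l * (u - 2 * of_int k)"
  have y: "\<bar>y\<bar> \<le> l" "\<bar>y\<bar> \<le> 1" "-1 \<le> y" "y \<le> 1" unfolding y_def using abs_arg_le[of k u] k l by auto
  define A where "A = pi / 2 / arcsin l * arcsin y"
  have abs_arcsin: "\<bar>arcsin y\<bar> = arcsin \<bar>y\<bar>"
    using y arcsin_less_arcsin[of y 0] arcsin_le_arcsin[of 0 y] by (cases "0 \<le> y") (auto simp: arcsin_minus)
  have A_abs: "\<bar>A\<bar> = pi / 2 / arcsin l * arcsin \<bar>y\<bar>"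
    unfolding A_def abs_mult abs_arcsin using arcsin_l by simp
  have nn: "0 \<le> arcsin \<bar>y\<bar>" using abs_arcsin by (metis abs_ge_zero)
  have "1 * arcsin \<bar>y\<bar> \<le> pi / 2 / arcsin l * arcsin \<bar>y\<bar>"
    using arcsin_l nn by (intro mult_right_mono) (auto simp: field_simps)
  moreover have "pi / 2 / arcsin l * arcsin \<bar>y\<bar> \<le> pi / 2 / arcsin l * arcsin l"
    using arcsin_l y l by (intro mult_left_mono arcsin_le_arcsin) auto
  ultimately have "arcsin \<bar>y\<bar> \<le> \<bar>A\<bar>" "\<bar>A\<bar> \<le> pi/2"
    unfolding A_abs using arcsin_l by auto
  then have "cos \<bar>A\<bar> \<le> cos (arcsin \<bar>y\<bar>)" "0 \<le> cos \<bar>A\<bar>"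
    using nn pi_gt_zero by (intro cos_monotone_0_pi_le cos_ge_zero; linarith)+
  then have cosA: "0 \<le> cos A" "cos A \<le> sqrt (1 - y\<^sup>2)"
    using y by (auto simp: cos_arcsin)
  have "\<bar>cos (of_int k * pi + A)\<bar> = \<bar>cos A\<bar>"
  proof -
    have "sin (of_int k * pi) = 0" by (metis sin_zero_iff_int2)
    moreover from this have "\<bar>cos (of_int k * pi)\<bar> = 1"
      using sin_zero_abs_cos_one by blast
    ultimately show ?thesis by (simp add: cos_add abs_mult)
  qed
  then have c: "\<bar>cos (arc_stair l u)\<bar> = cos A"
    using arc_stair_eq(1)[of k u] k cosA unfolding A_def y_def by simp
  have "arc_stair_deriv l u * \<bar>cos (arc_stair l u)\<bar> = pi / 2 * l / arcsin l * (cos A / sqrt (1 - y\<^sup>2))"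
    using arc_stair_eq(2)[of k u] k unfolding c y_def by simp
  \<comment> \<open>If \<open>|y| = 1\<close>, the quotient is 0 by convention.\<close>
  also have "\<dots> \<le> pi / 2 * l / arcsin l * 1"
    using arcsin_l l cosA y(2) by (intro mult_left_mono) (auto simp: divide_le_eq_1 abs_square_le_1 less_le)
  finally show ?thesis by simp
qed

lemma arc_stair_deriv_powr_integrable:
  assumes q: "0 \<le> q" "l < 1 \<or> q < 2"
  shows "(\<lambda>u. arc_stair_deriv l u powr q) integrable_on {-1..2 * real n + 1}"
proof (induction n)
  have piece: "(\<lambda>u. arc_stair_deriv l u powr q) integrable_on {2 * of_int k - 1..2 * of_int k + 1}" for k :: int
  proof -
    obtain I where "((\<lambda>x. (1 / sqrt (1 - (l * x)\<^sup>2)) powr q) has_integral I) (cbox (-1) 1)"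
      using integrable_inverse_sqrt_powr[OF l q] by auto
    from has_integral_affinity'[OF this, of 1 "- 2 * of_int k"]
    have "(\<lambda>u. (1 / sqrt (1 - (l * (u - 2 * of_int k))\<^sup>2)) powr q) integrable_on {2 * of_int k - 1..2 * of_int k + 1}"
      by (auto simp: algebra_simps)
    then have "(\<lambda>u. (pi / 2 * l / arcsin l) powr q * (1 / sqrt (1 - (l * (u - 2 * of_int k))\<^sup>2)) powr q)
        integrable_on {2 * of_int k - 1..2 * of_int k + 1}"
      by (rule integrable_on_mult_right)
    then show ?thesis
    proof (rule integrable_eq)
      fix u assume u: "u \<in> {2 * real_of_int k - 1..2 * of_int k + 1}"
      then have "(l * (u - 2 * of_int k))\<^sup>2 \<le> 1"
        using abs_arg_le[of k u] l by (simp add: abs_square_le_1)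
      then show "(pi / 2 * l / arcsin l) powr q * (1 / sqrt (1 - (l * (u - 2 * of_int k))\<^sup>2)) powr q = arc_stair_deriv l u powr q"
        using arc_stair_eq(2)[of k u] u arcsin_l l by (subst powr_mult[symmetric]) auto
    qed
  qed
  case 0
  show ?case using piece[of 0] by simp
  case (Suc n)
  have "(\<lambda>u. arc_stair_deriv l u powr q) integrable_on {2 * real n + 1..2 * real (Suc n) + 1}"
    using piece[of "int (Suc n)"] by (simp add: algebra_simps)
  then show ?case
    using Suc Henstock_Kurzweil_Integration.integrable_combine[of "-1" "2 * real n + 1" "2 * real (Suc n) + 1"] by simp
qed

end

section \<open>Competitors and the upper bound\<close>

lemma W1p_circle_cis:
  assumes "finite S" and cont: "continuous_on {0..2*pi} \<phi>"
    and der: "\<And>t. t \<in> {0<..<2*pi} - S \<Longrightarrow> (\<phi> has_real_derivative \<phi>' t) (at t)"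
    and int: "(\<lambda>t. \<bar>\<phi>' t\<bar>) integrable_on {0..2*pi}" "(\<lambda>t. \<bar>\<phi>' t\<bar> powr p) integrable_on {0..2*pi}"
    and period: "\<phi> (2*pi) - \<phi> 0 = 2 * pi * of_int n"
  shows "W1p_circle p (\<lambda>t. cis (\<phi> t)) (\<lambda>t. \<i> * complex_of_real (\<phi>' t) * cis (\<phi> t))" (is "W1p_circle p ?F ?G")
proof -
  have ftc: "(?G has_integral (cis (\<phi> t) - cis (\<phi> 0))) {0..t}" if t: "t \<in> {0..2*pi}" for t
  proof (rule fundamental_theorem_of_calculus_interior_strong[OF \<open>finite S\<close>])
    show "continuous_on {0..t} ?F"
      using cont t by (intro continuous_intros continuous_on_subset[OF cont]) auto
    fix x assume "x \<in> {0<..<t} - S"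
    then have "(\<phi> has_real_derivative \<phi>' x) (at x)" using der t by auto
    from has_derivative_cis[OF this[unfolded has_field_derivative_def]]
    show "(?F has_vector_derivative ?G x) (at x)"
      by (simp add: has_vector_derivative_def scaleR_conv_of_real mult_ac)
  qed (use t in auto)
  have G_int: "?G integrable_on {0..2*pi}" using ftc[of "2*pi"] by auto
  have norm_G: "norm (?G t) = \<bar>\<phi>' t\<bar>" for t by (simp add: norm_mult)
  have loop: "cis (\<phi> (2*pi)) = cis (\<phi> 0)"
  proof -
    have "\<phi> (2*pi) = \<phi> 0 + 2 * pi * of_int n" using period by simp
    moreover have "cis (2 * pi * of_int n) = 1" by (rule cis_multiple_2pi) simp
    ultimately show ?thesis by (simp flip: cis_mult)
  qed
  show ?thesis
    unfolding W1p_circle_def norm_G norm_cis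
  proof (intro conjI ballI absolutely_integrable_onI G_int int loop refl)
    show "(\<lambda>t. norm (?G t)) integrable_on {0..2*pi}"
      unfolding norm_G by (rule int(1))
    show "cis (\<phi> t) = cis (\<phi> 0) + integral {0..t} ?G" if "t \<in> {0..2*pi}" for t
      using integral_unique[OF ftc[OF that]] by simp
  qed
qed

text \<open>On \<open>[0, L]\<close> the angle \<open>\<eta>\<close> climbs the stair to
  \<open>n * pi\<close> while \<open>m\<close> rests; afterwards \<open>f = g\<close>, and both
  rotate together to gain the missing degree at no cost. With \<open>l < 1\<close> the slope stays
  bounded; \<open>L = 2*pi\<close> leaves no time to rotate.\<close>

lemma energies_upper_bound:
  fixes p l L :: real and d1 d2 :: int
  assumes p: "1 \<le> p" and deg: "d2 < d1"
    and l: "0 < l" "l \<le> 1" and lp: "l < 1 \<or> p < 2"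
    and L: "0 < L" "L \<le> 2*pi" and Ld: "L < 2*pi \<or> d1 + d2 = 0"
  obtains e where "e \<in> energies p d1 d2"
    "e \<le> 4 * of_int (d1 - d2) * (pi / 2 * l / arcsin l) * L powr (1/p - 1)"
proof -
  define n where "n = nat (d1 - d2)"
  have n: "real n = of_int (d1 - d2)" "0 < real n" using deg unfolding n_def by auto
  \<comment> \<open>This rate brings the stair to \<open>2 * n\<close>, where its height is
    \<open>n * pi\<close>, exactly at time \<open>L\<close>.\<close>
  define r where "r = 2 * real n / L"
  have r: "0 < r" "r * L = 2 * real n" using n L unfolding r_def by auto
  define \<eta> where "\<eta> t = arc_stair l (r * min t L)" for t
  define \<eta>' where "\<eta>' t = (if t \<le> L then r * arc_stair_deriv l (r * t) else 0)" for t
  \<comment> \<open>If \<open>L = 2*pi\<close>, then \<open>d1 + d2 = 0\<close> and this is 0;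
    otherwise \<open>m\<close> gains \<open>(d1 + d2) * pi\<close> after \<open>L\<close>.\<close>
  define v where "v = of_int (d1 + d2) * pi / (2*pi - L)"
  define m where "m t = v * max 0 (t - L)" for t
  define m' where "m' t = (if t \<le> L then 0 else v)" for t
  \<comment> \<open>Contains the junction \<open>L\<close> and the times at which the stair passes
    odd integers.\<close>
  define E where "E = insert L ((\<lambda>j::nat. real j / r) ` {..2 * n})"
  have "finite E" unfolding E_def by simp

  have cont_\<eta>: "continuous_on {0..2*pi} \<eta>"
    unfolding \<eta>_def
  proof (rule continuous_on_compose2[OF continuous_on_arc_stair[OF l, of n]])
    show "(\<lambda>t. r * min t L) ` {0..2*pi} \<subseteq> {- 1..2 * real n + 1}"
    proof clarify
      fix t assume t: "t \<in> {0..2*pi}"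
      have "r * min t L \<le> r * L" "0 \<le> r * min t L"
        using r(1) L t by (auto intro!: mult_left_mono mult_nonneg_nonneg)
      then show "r * min t L \<in> {- 1..2 * real n + 1}" using r by simp
    qed
  qed (intro continuous_intros)
  have cont_m: "continuous_on {0..2*pi} m"
    unfolding m_def by (intro continuous_intros)

  have der_\<eta>: "(\<eta> has_real_derivative \<eta>' t) (at t)" if t: "t \<in> {0<..<2*pi} - E" for t
  proof (cases "t < L")
    case True
    obtain k where k: "2 * of_int k - 1 \<le> r * t" "r * t < 2 * of_int k + 1" by (rule nearest_even)
    have "r * t \<noteq> 2 * of_int k - 1"
    proof
      assume eq: "r * t = 2 * of_int k - 1"
      have "0 < r * t" "r * t < r * L" using r(1) t True by auto
      then have "0 < real_of_int (2 * k - 1)" "real_of_int (2 * k - 1) < real_of_int (int (2 * n))"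
        using eq r by auto
      then have "0 < 2 * k - 1" "2 * k - 1 < int (2 * n)" by linarith+
      then have "nat (2 * k - 1) \<in> {..2 * n}" "real (nat (2 * k - 1)) = r * t"
        unfolding eq by auto
      moreover from this have "t = real (nat (2 * k - 1)) / r" using r(1) by simp
      ultimately show False using t unfolding E_def by blast
    qed
    then have "(arc_stair l has_real_derivative arc_stair_deriv l (r * t)) (at (r * t))"
      using k by (intro arc_stair_has_derivative[OF l, of k]) auto
    from DERIV_chain'[OF DERIV_cmult_Id this]
    have "((\<lambda>t. arc_stair l (r * t)) has_real_derivative \<eta>' t) (at t)"
      using True unfolding \<eta>'_def by (simp add: mult.commute[of r "arc_stair_deriv l (r * t)"])
    then show ?thesis
      by (rule has_field_derivative_transform_within_open[of _ _ _ "{..<L}"]) (use True in \<open>auto simp: \<eta>_def\<close>)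
  next
    case False
    then have "L < t" using t unfolding E_def by auto
    then have "((\<lambda>t. arc_stair l (r * L)) has_real_derivative \<eta>' t) (at t)"
      unfolding \<eta>'_def by auto
    then show ?thesis
      by (rule has_field_derivative_transform_within_open[of _ _ _ "{L<..}"]) (use \<open>L < t\<close> in \<open>auto simp: \<eta>_def\<close>)
  qed
  have der_m: "(m has_real_derivative m' t) (at t)" if t: "t \<in> {0<..<2*pi} - E" for t
  proof (cases "t < L")
    case True
    then have "((\<lambda>t. 0) has_real_derivative m' t) (at t)"
      unfolding m'_def by auto
    then show ?thesis
      by (rule has_field_derivative_transform_within_open[of _ _ _ "{..<L}"]) (use True in \<open>auto simp: m_def\<close>)
  next
    case False
    then have "L < t" using t unfolding E_def by auto
    then have "((\<lambda>t. v * (t - L)) has_real_derivative m' t) (at t)"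
      unfolding m'_def by (auto intro!: derivative_eq_intros)
    then show ?thesis
      by (rule has_field_derivative_transform_within_open[of _ _ _ "{L<..}"]) (use \<open>L < t\<close> in \<open>auto simp: m_def\<close>)
  qed

  \<comment> \<open>The signs of \<open>\<sigma>\<close> give the slopes of the two angles, and
    \<open>q\<close> will be 1 and \<open>p\<close>.\<close>
  have int: "(\<lambda>t. \<bar>m' t + \<sigma> * \<eta>' t\<bar> powr q) integrable_on {0..2*pi}"
    if q: "1 \<le> q" "l < 1 \<or> q < 2" and \<sigma>: "\<bar>\<sigma>\<bar> = 1" for q \<sigma> :: real
  proof (rule Henstock_Kurzweil_Integration.integrable_combine[OF less_imp_le[OF L(1)] L(2)])
    have "(\<lambda>u. arc_stair_deriv l u powr q) integrable_on {0..2 * real n}"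
      using arc_stair_deriv_powr_integrable[OF l, of q n] q by (auto intro: integrable_on_subinterval)
    then obtain I where "((\<lambda>u. arc_stair_deriv l u powr q) has_integral I) (cbox 0 (2 * real n))" by auto
    from has_integral_affinity'[OF this r(1), of 0]
    have "(\<lambda>t. arc_stair_deriv l (r * t) powr q) integrable_on {0..2 * real n / r}"
      by (auto simp: divide_inverse_commute)
    also have "2 * real n / r = L" using r by (simp add: field_simps)
    finally have "(\<lambda>t. r powr q * arc_stair_deriv l (r * t) powr q) integrable_on {0..L}"
      by (rule integrable_on_mult_right)
    then show "(\<lambda>t. \<bar>m' t + \<sigma> * \<eta>' t\<bar> powr q) integrable_on {0..L}"
      by (rule integrable_eq)
         (use \<sigma> r(1) arc_stair_deriv_nonneg[OF l] in \<open>auto simp: m'_def \<eta>'_def abs_mult powr_mult\<close>)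
    show "(\<lambda>t. \<bar>m' t + \<sigma> * \<eta>' t\<bar> powr q) integrable_on {L..2*pi}"
    proof (rule integrable_spike_finite[of "{L}"])
      show "(\<lambda>t. \<bar>v\<bar> powr q) integrable_on {L..2*pi}" by (rule integrable_const_ivl)
    qed (auto simp: m'_def \<eta>'_def)
  qed

  have ends: "\<eta> 0 = 0" "m 0 = 0" "\<eta> (2*pi) = real n * pi" "m (2*pi) = of_int (d1 + d2) * pi"
    using L Ld arc_stair_0[OF l] arc_stair_even[OF l, of n] r unfolding \<eta>_def m_def v_def by auto

  define \<phi> \<psi> where "\<phi> t = m t + \<eta> t" and "\<psi> t = m t - \<eta> t" for t
  define \<phi>' \<psi>' where "\<phi>' t = m' t + \<eta>' t" and "\<psi>' t = m' t - \<eta>' t" for t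
  define F G where "F t = cis (\<phi> t)" and "G t = \<i> * complex_of_real (\<phi>' t) * cis (\<phi> t)" for t
  define H K where "H t = cis (\<psi> t)" and "K t = \<i> * complex_of_real (\<psi>' t) * cis (\<psi> t)" for t
  have cont: "continuous_on {0..2*pi} \<phi>" "continuous_on {0..2*pi} \<psi>"
    unfolding \<phi>_def \<psi>_def by (intro continuous_intros cont_m cont_\<eta>)+
  have period: "\<phi> (2*pi) - \<phi> 0 = 2 * pi * of_int d1" "\<psi> (2*pi) - \<psi> 0 = 2 * pi * of_int d2"
    unfolding \<phi>_def \<psi>_def ends n(1) by (auto simp: algebra_simps)
  have int_\<phi>: "(\<lambda>t. \<bar>\<phi>' t\<bar> powr q) integrable_on {0..2*pi}"
    and int_\<psi>: "(\<lambda>t. \<bar>\<psi>' t\<bar> powr q) integrable_on {0..2*pi}"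
    if "1 \<le> q" "l < 1 \<or> q < 2" for q
    using int[OF that, of 1] int[OF that, of "-1"] unfolding \<phi>'_def \<psi>'_def by simp_all
  have WF: "W1p_circle p F G"
    unfolding F_def G_def
    using der_\<eta> der_m int_\<phi>[of 1] int_\<phi>[OF p lp] period(1) cont(1)
    by (intro W1p_circle_cis[OF \<open>finite E\<close>]) (auto simp: \<phi>_def \<phi>'_def intro!: derivative_eq_intros)
  have WH: "W1p_circle p H K"
    unfolding H_def K_def
    using der_\<eta> der_m int_\<psi>[of 1] int_\<psi>[OF p lp] period(2) cont(2)
    by (intro W1p_circle_cis[OF \<open>finite E\<close>]) (auto simp: \<psi>_def \<psi>'_def intro!: derivative_eq_intros)
  have degs: "circ_deg F = of_int d1" "circ_deg H = of_int d2"
    unfolding F_def H_def by (intro circ_deg_cis cont period)+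

  define C where "C = pi / 2 * l / arcsin l"
  have C: "0 < C" unfolding C_def using l arcsin_l[OF l] by simp
  \<comment> \<open>Up to \<open>L\<close> the difference of derivatives is
    \<open>2 * i * \<eta>' * cos \<eta>\<close>; later the two angles differ by a multiple of
    \<open>2 * pi\<close> and have equal slopes.\<close>
  have bound: "norm (G t - K t) powr p \<le> (if t \<in> {0..L} then (2 * r * C) powr p else 0)"
    if t: "t \<in> {0..2*pi}" for t
  proof (cases "t \<le> L")
    case True
    have "G t - K t = \<i> * complex_of_real (\<eta>' t) * (cis (\<eta> t) + cis (- \<eta> t))"
      using True unfolding G_def K_def \<phi>'_def \<psi>'_def \<phi>_def \<psi>_def m_def m'_def by (simp add: algebra_simps)
    also have "cis (\<eta> t) + cis (- \<eta> t) = complex_of_real (2 * cos (\<eta> t))"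
      by (simp add: complex_eq_iff)
    finally have "norm (G t - K t) = \<bar>\<eta>' t\<bar> * (2 * \<bar>cos (\<eta> t)\<bar>)"
      by (simp add: norm_mult abs_mult)
    also have "\<dots> = 2 * r * (arc_stair_deriv l (r * t) * \<bar>cos (arc_stair l (r * t))\<bar>)"
      using True r(1) arc_stair_deriv_nonneg[OF l] unfolding \<eta>'_def \<eta>_def by (simp add: abs_mult)
    also have "\<dots> \<le> 2 * r * C"
      using r(1) arc_stair_speed_le[OF l] unfolding C_def by (intro mult_left_mono) auto
    finally show ?thesis using True t p by (auto intro!: powr_mono2)
  next
    case False
    then have "\<eta> t = real n * pi" "\<eta>' t = 0"
      using arc_stair_even[OF l, of n] r unfolding \<eta>_def \<eta>'_def by auto
    then have "G t - K t = \<i> * complex_of_real (m' t) * (cis (\<phi> t) - cis (\<psi> t))" "\<phi> t - \<psi> t = 2 * (real n * pi)"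
      unfolding G_def K_def \<phi>'_def \<psi>'_def \<phi>_def \<psi>_def by (auto simp: algebra_simps)
    then have "norm (G t - K t) = 0"
      by (simp add: norm_mult norm_cis_diff)
    then show ?thesis using False by simp
  qed
  have "((\<lambda>t. (2 * r * C) powr p) has_integral (L * (2 * r * C) powr p)) {0..L}"
    using has_integral_const_real[of "(2 * r * C) powr p" 0 L] L by simp
  then have "((\<lambda>t. if t \<in> {0..L} then (2 * r * C) powr p else 0) has_integral (L * (2 * r * C) powr p)) {0..2*pi}"
    using L by (subst has_integral_restrict) auto
  then have "integral {0..2*pi} (\<lambda>t. norm (G t - K t) powr p) \<le> L * (2 * r * C) powr p"
    using has_integral_le[OF integrable_integral[OF W1p_circle_powr_diff_integrable[OF WF WH p]] _ bound] by blast
  moreover have "0 \<le> integral {0..2*pi} (\<lambda>t. norm (G t - K t) powr p)"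
    by (intro Henstock_Kurzweil_Integration.integral_nonneg W1p_circle_powr_diff_integrable[OF WF WH p]) auto
  ultimately have "Lp_dist p G K \<le> (L * (2 * r * C) powr p) powr (1/p)"
    unfolding Lp_dist_def using p by (intro powr_mono2) auto
  also have "\<dots> = L powr (1/p) * (2 * r * C)"
    using L r C p by (simp add: powr_mult powr_powr)
  also have "\<dots> = 4 * real n * C * L powr (1/p - 1)"
    using L unfolding r_def by (simp add: powr_diff field_simps)
  finally have "Lp_dist p G K \<le> 4 * of_int (d1 - d2) * (pi / 2 * l / arcsin l) * L powr (1/p - 1)"
    unfolding n(1) C_def .
  moreover have "Lp_dist p G K \<in> energies p d1 d2"
    unfolding energies_def using WF WH degs by blast
  ultimately show ?thesis using that by blast
qed

section \<open>The infimum and its attainment\<close>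

lemma energies_commute: "energies p d1 d2 = energies p d2 d1"
proof -
  have "Lp_dist p G K = Lp_dist p K G" for G K
    unfolding Lp_dist_def by (simp add: norm_minus_commute)
  then show ?thesis unfolding energies_def by blast
qed

lemma energies_lower_bound:
  assumes p: "1 \<le> p" and deg: "d2 < d1" and e: "e \<in> energies p d1 d2"
  defines "V \<equiv> 2 powr (1/p + 1) * pi powr (1/p - 1) * real_of_int (d1 - d2)"
  shows "V \<le> e" and "\<lbrakk>1 < p; e = V\<rbrakk> \<Longrightarrow> d2 = - d1 \<and> p < 2"
proof -
  obtain F G H K where W: "W1p_circle p F G" "W1p_circle p H K"
    and degs: "circ_deg F = of_int d1" "circ_deg H = of_int d2" and e: "e = Lp_dist p G K"
    using e unfolding energies_def by blast
  obtain \<phi> where \<phi>: "continuous_on {0..2*pi} \<phi>"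
    "\<And>t. t \<in> {0..2*pi} \<Longrightarrow> F t = cis (\<phi> t)" "\<phi> (2*pi) - \<phi> 0 = 2 * pi * of_int d1"
    using W1p_circle_lift[OF W(1) degs(1)] by blast
  obtain \<psi> where \<psi>: "continuous_on {0..2*pi} \<psi>"
    "\<And>t. t \<in> {0..2*pi} \<Longrightarrow> H t = cis (\<psi> t)" "\<psi> (2*pi) - \<psi> 0 = 2 * pi * of_int d2"
    using W1p_circle_lift[OF W(2) degs(2)] by blast
  interpret circle_pair p F G H K d1 d2 \<phi> \<psi>
    by (rule circle_pair.intro[OF p W \<phi>(1) \<psi>(1) \<phi>(2) \<psi>(2) \<phi>(3) \<psi>(3) deg])
  show "V \<le> e"
    using Lp_dist_ge unfolding V_def e d_def .
  show "d2 = - d1 \<and> p < 2" if "1 < p" "e = V"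
    using optimal_imp_opposite optimal_imp_less_2 that unfolding V_def e d_def by blast
qed

lemma optimal_value_alt: "4 * d * (2*pi) powr (1/p - 1) = 2 powr (1/p + 1) * pi powr (1/p - 1) * d"
  by (simp add: powr_mult powr_diff powr_add)

text \<open>Competitors with \<open>l < 1\<close> and \<open>L < 2*pi\<close> exist for every
  \<open>p\<close> and every pair of degrees; their bounds tend to \<open>V\<close> as
  \<open>l\<close> tends to 1 and \<open>L\<close> to \<open>2*pi\<close>.\<close>

lemma energies_Inf:
  fixes p :: real and d1 d2 :: int
  assumes p: "1 \<le> p" and deg: "d2 < d1"
  defines "V \<equiv> 2 powr (1/p + 1) * pi powr (1/p - 1) * real_of_int (d1 - d2)"
  shows "Inf (energies p d1 d2) = V"
proof (rule antisym)
  have bdd: "bdd_below (energies p d1 d2)"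
    using energies_lower_bound(1)[OF p deg] unfolding bdd_below_def by blast
  \<comment> \<open>Any admissible parameters would do here: the set must only be nonempty.\<close>
  obtain e where "e \<in> energies p d1 d2"
    using energies_upper_bound[OF p deg, of "1/2" pi] by auto
  then show "V \<le> Inf (energies p d1 d2)"
    unfolding V_def by (intro cInf_greatest energies_lower_bound(1)[OF p deg]) auto
  \<comment> \<open>The double successor keeps \<open>l 0\<close> positive.\<close>
  define l where "l N = 1 - inverse (real (Suc (Suc N)))" for N
  define L where "L N = 2 * pi - inverse (real (Suc N))" for N
  define U where "U N = 4 * of_int (d1 - d2) * (pi / 2 * l N / arcsin (l N)) * L N powr (1/p - 1)" for N
  have l: "0 < l N" "l N < 1" for N
    unfolding l_def by (auto simp: field_simps)
  have L: "0 < L N" "L N < 2*pi" for N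
  proof -
    have "inverse (real (Suc N)) \<le> 1" by (simp add: field_simps)
    then show "0 < L N" "L N < 2*pi" unfolding L_def using pi_gt3 by simp_all
  qed
  have "Inf (energies p d1 d2) \<le> U N" for N
  proof -
    obtain e where e: "e \<in> energies p d1 d2" "e \<le> U N"
      using energies_upper_bound[OF p deg, of "l N" "L N"] l[of N] L[of N] unfolding U_def by auto
    then show ?thesis using cInf_lower[OF e(1) bdd] by linarith
  qed
  moreover have "U \<longlonglongrightarrow> V"
  proof -
    have liml: "l \<longlonglongrightarrow> 1"
      unfolding l_def using LIMSEQ_Suc[OF LIMSEQ_inverse_real_of_nat] tendsto_diff[OF tendsto_const[of 1]] by fastforce
    have limL: "L \<longlonglongrightarrow> 2*pi"
      unfolding L_def using LIMSEQ_inverse_real_of_nat tendsto_diff[OF tendsto_const[of "2*pi"]] by fastforce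
    have "(\<lambda>N. arcsin (l N)) \<longlonglongrightarrow> arcsin 1"
      using l by (intro continuous_on_tendsto_compose[OF continuous_on_arcsin' liml])
        (auto intro!: always_eventually less_imp_le[OF l(2)] simp: order.trans[OF _ less_imp_le[OF l(1)]])
    then have "U \<longlonglongrightarrow> 4 * of_int (d1 - d2) * (pi / 2 * 1 / arcsin 1) * (2*pi) powr (1/p - 1)"
      unfolding U_def by (intro tendsto_intros liml limL) auto
    also have "4 * of_int (d1 - d2) * (pi / 2 * 1 / arcsin 1) * (2*pi) powr (1/p - 1) = V"
      using optimal_value_alt[of "real_of_int (d1 - d2)" p] unfolding V_def by simp
    finally show ?thesis .
  qed
  ultimately show "Inf (energies p d1 d2) \<le> V"
    by (intro LIMSEQ_le_const) auto
qed

lemma energies_attained: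
  fixes p :: real and d1 d2 :: int
  assumes p: "1 \<le> p" and deg: "d2 < d1" and "p = 1 \<or> p < 2 \<and> d2 = - d1"
  shows "Inf (energies p d1 d2) \<in> energies p d1 d2"
proof -
  define L where "L = (if p = 1 then pi else 2 * pi)"
  have "0 < L" "L \<le> 2*pi" "L < 2*pi \<or> d1 + d2 = 0" "p < 2" "arcsin 1 = pi/2"
    using assms unfolding L_def by auto
  then obtain e where e: "e \<in> energies p d1 d2"
    "e \<le> 4 * of_int (d1 - d2) * (pi / 2 * 1 / arcsin 1) * L powr (1/p - 1)"
    using energies_upper_bound[OF p deg, of 1 L] by auto
  note e(2)
  also have "4 * of_int (d1 - d2) * (pi / 2 * 1 / arcsin 1) * L powr (1/p - 1)
      = 2 powr (1/p + 1) * pi powr (1/p - 1) * real_of_int (d1 - d2)"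
    using optimal_value_alt[of "real_of_int (d1 - d2)" p] unfolding L_def by auto
  finally have "e \<le> Inf (energies p d1 d2)"
    unfolding energies_Inf[OF p deg] .
  moreover have "Inf (energies p d1 d2) \<le> e"
    using energies_lower_bound(1)[OF p deg e(1)] unfolding energies_Inf[OF p deg] .
  ultimately show ?thesis using e(1) by simp
qed

theorem theorem1p2:
  fixes p :: real and d1 d2 :: int
  assumes "1 \<le> p" and "d1 \<noteq> d2"
  shows "Inf (energies p d1 d2) = 2 powr (1/p + 1) * pi powr (1/p - 1) * real_of_int \<bar>d1 - d2\<bar>
       \<and> (p = 1 \<longrightarrow> Inf (energies p d1 d2) \<in> energies p d1 d2)
       \<and> (1 < p \<and> p < 2 \<longrightarrow> (Inf (energies p d1 d2) \<in> energies p d1 d2 \<longleftrightarrow> d2 = - d1))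
       \<and> (2 \<le> p \<longrightarrow> Inf (energies p d1 d2) \<notin> energies p d1 d2)"
proof -
  \<comment> \<open>Exchanging \<open>f\<close> and \<open>g\<close> preserves the energies, so the
    larger degree may be put first.\<close>
  have main: "Inf (energies p a b) = 2 powr (1/p + 1) * pi powr (1/p - 1) * real_of_int \<bar>a - b\<bar>
       \<and> (p = 1 \<longrightarrow> Inf (energies p a b) \<in> energies p a b)
       \<and> (1 < p \<and> p < 2 \<longrightarrow> (Inf (energies p a b) \<in> energies p a b \<longleftrightarrow> b = - a))
       \<and> (2 \<le> p \<longrightarrow> Inf (energies p a b) \<notin> energies p a b)" if "b < a" for a b :: int
  proof -
    have attained: "b = - a \<and> p < 2" if "1 < p" "Inf (energies p a b) \<in> energies p a b"
      using energies_lower_bound(2)[OF assms(1) \<open>b < a\<close> that(2) that(1)] energies_Inf[OF assms(1) \<open>b < a\<close>] by blast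
    show ?thesis
    proof (intro conjI impI iffI)
      show "Inf (energies p a b) = 2 powr (1/p + 1) * pi powr (1/p - 1) * real_of_int \<bar>a - b\<bar>"
        using energies_Inf[OF assms(1) that] that by simp
      show "Inf (energies p a b) \<in> energies p a b" if "p = 1"
        using energies_attained[OF assms(1) \<open>b < a\<close>] that by blast
      show "Inf (energies p a b) \<in> energies p a b" if "1 < p \<and> p < 2" "b = - a"
        using energies_attained[OF assms(1) \<open>b < a\<close>] that by blast
      show "b = - a" if "1 < p \<and> p < 2" "Inf (energies p a b) \<in> energies p a b"
        using attained that by blast
      show "Inf (energies p a b) \<notin> energies p a b" if "2 \<le> p"
        using attained that by linarith
    qed
  qed
  consider "d2 < d1" | "d1 < d2" using assms(2) by linarith
  then show ?thesis
  proof cases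
    case 1
    then show ?thesis by (rule main)
  next
    case 2
    have eq: "d1 = - d2 \<longleftrightarrow> d2 = - d1" by auto
    show ?thesis
      using main[OF 2] unfolding energies_commute[of p d2 d1] abs_minus_commute[of d2 d1] eq .
  qed
qed

end
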